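(* Let $P=\{p_1,-p_1,\ldots,p_n,-p_n\}$ be a centrally symmetric set of $2n$ points in $\mathbb{R}^d$, with $p_i$ labelled $+i$ and $-p_i$ labelled $-i$. Let $M$ be a closed PL manifold of dimension $d$ with a free simplicial involution $A$. Then $(M,A)$ is a BUT manifold if and only if for every equivariant triangulation $T$ of $M$ and every labelling $L:V(T)\to\{+1,-1,\ldots,+n,-n\}$ with $L(A(v))=-L(v)$ for all $v$, there exists a simplex $s$ of $T$ with $0\in f_{L,P}(s)$.
   Context: A free involution is a map $A:M\to M$ with $A(A(x))=x$, $A(x)\neq x$ for all $x$. A triangulation is equivariant if $A$ maps it simplicially onto itself. $(M,A)$ is BUT if every continuous $g:M\to\mathbb{R}^d$ has a point $x$ with $g(A(x))=g(x)$. $f_{L,P}:M\to\mathbb{R}^d$ is the piecewise linear map sending each vertex $v$ with $L(v)=i$ to $p_i$ and with $L(v)=-i$ to $-p_i$, extended linearly on each simplex of $T$.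
   Formalization: The "if" direction (every labelling hits 0 implies BUT) is stated only for P spanning R^d, since it fails otherwise (P={e1,-e1}, torus with A(z,w)=(-z,w)); the "only if" direction is stated for every P. *)

theory Defs
  imports "HOL-Analysis.Analysis"
begin

text \<open>
  Compact polyhedra are finite unions of polytopes in a Euclidean space. A map on one is piecewise
  linear if it is affine on each polytope of some such decomposition; because the polytopes are
  closed and finite in number, the map is then continuous.
\<close>

definition compact_polyhedron :: "'a::euclidean_space set \<Rightarrow> bool" where
  "compact_polyhedron S \<longleftrightarrow> (\<exists>C. finite C \<and> (\<forall>c\<in>C. polytope c) \<and> \<Union>C = S)"

definition pl_on :: "'a::euclidean_space set \<Rightarrow> ('a \<Rightarrow> 'b::euclidean_space) \<Rightarrow> bool" where
  "pl_on S f \<longleftrightarrow>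
     (\<exists>C. finite C \<and> (\<forall>c\<in>C. polytope c) \<and> \<Union>C = S \<and>
          (\<forall>c\<in>C. \<exists>l a. linear l \<and> (\<forall>x\<in>c. f x = l x + a)))"

definition pl_homeomorphism ::
  "'a::euclidean_space set \<Rightarrow> 'b::euclidean_space set \<Rightarrow> ('a \<Rightarrow> 'b) \<Rightarrow> ('b \<Rightarrow> 'a) \<Rightarrow> bool" where
  "pl_homeomorphism S T f g \<longleftrightarrow> homeomorphism S T f g \<and> pl_on S f \<and> pl_on T g"

text \<open>
  The chart condition is the usual one (a neighbourhood PL homeomorphic to an open subset of
  \<open>d\<close>-space), phrased with compact charts: \<open>N\<close> is a PL \<open>d\<close>-ball. Requiring \<open>x\<close> to be
  mapped to the interior of the simplex excludes boundary points. Connectedness is not required.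
\<close>

definition closed_pl_manifold :: "nat \<Rightarrow> 'a::euclidean_space set \<Rightarrow> bool" where
  "closed_pl_manifold d M \<longleftrightarrow>
     compact_polyhedron M \<and>
     (\<forall>x\<in>M. \<exists>N C f g. N \<subseteq> M \<and> x \<in> (top_of_set M) interior_of N \<and>
        int d simplex (C :: 'a set) \<and> pl_homeomorphism N C f g \<and> f x \<in> rel_interior C)"

definition abstract_complex :: "'v set set \<Rightarrow> bool" where
  "abstract_complex K \<longleftrightarrow>
     finite K \<and> (\<forall>s\<in>K. finite s \<and> s \<noteq> {}) \<and> (\<forall>s\<in>K. \<forall>t. t \<subseteq> s \<and> t \<noteq> {} \<longrightarrow> t \<in> K)"

text \<open>Points of the geometric realization are given by their barycentric coordinates.\<close>

definition realization :: "'v set set \<Rightarrow> ('v \<Rightarrow> real) set" where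
  "realization K = {w. (\<forall>v. 0 \<le> w v) \<and> {v. w v \<noteq> 0} \<in> K \<and> (\<Sum>v\<in>\<Union>K. w v) = 1}"

text \<open>
  A triangulation of \<open>M\<close> is a finite complex \<open>K\<close> with a PL homeomorphism from \<open>M\<close> onto its
  realization. Each vertex is identified with the point of \<open>M\<close> that it represents, and \<open>\<beta> x v\<close> is
  the barycentric coordinate of the point \<open>x\<close> with respect to the vertex \<open>v\<close>. The simplices need
  not be straight in the ambient Euclidean space of \<open>M\<close>.
\<close>

definition pl_triangulation ::
  "'a::euclidean_space set \<Rightarrow> 'a set set \<Rightarrow> ('a \<Rightarrow> 'a \<Rightarrow> real) \<Rightarrow> bool" where
  "pl_triangulation M K \<beta> \<longleftrightarrow>
     abstract_complex K \<and> \<Union>K \<subseteq> M \<and>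
     (\<exists>h. homeomorphism M (realization K) \<beta> h) \<and>
     (\<forall>v\<in>\<Union>K. \<beta> v = (\<lambda>u. if u = v then 1 else 0)) \<and>
     (\<forall>v\<in>\<Union>K. pl_on M (\<lambda>x. \<beta> x v))"

definition simplex_points ::
  "'a set \<Rightarrow> ('a \<Rightarrow> 'a \<Rightarrow> real) \<Rightarrow> 'a set \<Rightarrow> 'a set" where
  "simplex_points M \<beta> s = {x\<in>M. {v. \<beta> x v \<noteq> 0} \<subseteq> s}"

definition free_involution :: "'a set \<Rightarrow> ('a \<Rightarrow> 'a) \<Rightarrow> bool" where
  "free_involution M A \<longleftrightarrow> A ` M \<subseteq> M \<and> (\<forall>x\<in>M. A (A x) = x \<and> A x \<noteq> x)"

text \<open>
  For an involution \<open>A\<close>: it sends simplices to simplices and is affine on each of them. That \<open>A\<close>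
  maps the complex onto itself then follows from \<open>A (A x) = x\<close>.
\<close>

definition equivariant ::
  "'a set \<Rightarrow> ('a \<Rightarrow> 'a) \<Rightarrow> 'a set set \<Rightarrow> ('a \<Rightarrow> 'a \<Rightarrow> real) \<Rightarrow> bool" where
  "equivariant M A K \<beta> \<longleftrightarrow>
     (\<forall>s\<in>K. A ` s \<in> K) \<and> (\<forall>x\<in>M. \<forall>v\<in>\<Union>K. \<beta> (A x) (A v) = \<beta> x v)"

definition free_simplicial_involution :: "'a::euclidean_space set \<Rightarrow> ('a \<Rightarrow> 'a) \<Rightarrow> bool" where
  "free_simplicial_involution M A \<longleftrightarrow>
     free_involution M A \<and> (\<exists>K \<beta>. pl_triangulation M K \<beta> \<and> equivariant M A K \<beta>)"

text \<open>The type argument \<open>'d\<close> is the target Euclidean space of the test maps.\<close>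

definition BUT ::
  "'d::euclidean_space itself \<Rightarrow> 'a::euclidean_space set \<Rightarrow> ('a \<Rightarrow> 'a) \<Rightarrow> bool" where
  "BUT _ M A \<longleftrightarrow>
     (\<forall>g :: 'a \<Rightarrow> 'd. continuous_on M g \<longrightarrow> (\<exists>x\<in>M. g (A x) = g x))"

definition point_set :: "nat \<Rightarrow> (nat \<Rightarrow> 'd::euclidean_space) \<Rightarrow> 'd set" where
  "point_set n p = p ` {1..n} \<union> (\<lambda>i. - p i) ` {1..n}"

definition labelled_point :: "(nat \<Rightarrow> 'd::euclidean_space) \<Rightarrow> int \<Rightarrow> 'd" where
  "labelled_point p i = (if i > 0 then p (nat i) else - p (nat (- i)))"

definition equivariant_labelling ::
  "nat \<Rightarrow> ('a \<Rightarrow> 'a) \<Rightarrow> 'a set set \<Rightarrow> ('a \<Rightarrow> int) \<Rightarrow> bool" where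
  "equivariant_labelling n A K L \<longleftrightarrow>
     (\<forall>v\<in>\<Union>K. L v \<in> {1..int n} \<union> {- int n..-1} \<and> L (A v) = - L v)"

definition pl_extension ::
  "'a set set \<Rightarrow> ('a \<Rightarrow> 'a \<Rightarrow> real) \<Rightarrow> ('a \<Rightarrow> int) \<Rightarrow> (nat \<Rightarrow> 'd::euclidean_space) \<Rightarrow> 'a \<Rightarrow> 'd" where
  "pl_extension K \<beta> L p x = (\<Sum>v\<in>\<Union>K. \<beta> x v *\<^sub>R labelled_point p (L v))"

definition every_labelling_hits_zero ::
  "'a::euclidean_space set \<Rightarrow> ('a \<Rightarrow> 'a) \<Rightarrow> nat \<Rightarrow> (nat \<Rightarrow> 'd::euclidean_space) \<Rightarrow> bool" where
  "every_labelling_hits_zero M A n p \<longleftrightarrow>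
     (\<forall>K \<beta> L. pl_triangulation M K \<beta> \<and> equivariant M A K \<beta> \<and> equivariant_labelling n A K L
        \<longrightarrow> (\<exists>s\<in>K. 0 \<in> pl_extension K \<beta> L p ` simplex_points M \<beta> s))"

end

theory Submission
  imports Defs
begin

text \<open>
  If \<open>(M, A)\<close> is BUT, the piecewise linear extension of an antisymmetric labelling is an odd map, so
  it takes equal values at some \<open>x\<close> and \<open>A x\<close>, and these values vanish. Conversely, a map \<open>g\<close> without
  such a point yields the odd nowhere zero map \<open>f x = g x - g (A x)\<close>. Iterated barycentric
  subdivision is equivariant and makes the variation of \<open>f\<close> on each simplex small; labelling every
  vertex by the dominant coordinate of \<open>f\<close> and its sign then keeps \<open>0\<close> out of all image simplices.

  The subdivision is handled through coordinates: the barycentric coordinates of a point are a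
  positive combination of indicator functions of a chain of simplices, and the coefficient of a
  simplex \<open>s\<close> is the gap between the smallest coordinate on \<open>s\<close> and the largest one off \<open>s\<close>. This
  explicit formula shows that the new coordinates are again piecewise linear.
\<close>

section \<open>Piecewise linear functions\<close>

text \<open>The simplices of a triangulation may be curved in the ambient space, so ambient averages
  and straight-line diameter estimates are of no use for controlling subdivisions. Size is measured
  instead by the barycentric coordinates of the initial triangulation, because these remain affine
  on the simplices of every subdivision. If no simplex has more than \<open>N\<close> vertices, one
  subdivision multiplies the bound on their variation along a simplex by 1 - 1/\<open>N\<close>, and
  the bound \<open>N\<close> is inherited. Compactness of \<open>M\<close> and injectivity of the
  coordinate map then turn small variation of coordinates into small variation of given continuous
  functions. The dominant coordinate is taken with respect to a basis contained in the given points,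
  so that every basis vector is available as a label. This is where the spanning condition of the
  backward direction enters.\<close>

lemma pl_onI:
  assumes "finite C" "\<And>c. c \<in> C \<Longrightarrow> polytope c" "\<Union>C = S"
    "\<And>c. c \<in> C \<Longrightarrow> \<exists>l a. linear l \<and> (\<forall>x\<in>c. f x = l x + a)"
  shows "pl_on S f"
  unfolding pl_on_def using assms by (intro exI[of _ C] conjI ballI) assumption+

lemma pl_onE:
  assumes "pl_on S f"
  obtains C where "finite C" "\<And>c. c \<in> C \<Longrightarrow> polytope c" "\<Union>C = S"
    "\<And>c. c \<in> C \<Longrightarrow> \<exists>l a. linear l \<and> (\<forall>x\<in>c. f x = l x + a)"
proof -
  from assms obtain C where C: "finite C \<and> (\<forall>c\<in>C. polytope c) \<and> \<Union>C = S \<and>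
      (\<forall>c\<in>C. \<exists>l a. linear l \<and> (\<forall>x\<in>c. f x = l x + a))"
    unfolding pl_on_def by (rule exE)
  show ?thesis
    by (rule that[of C]) (use C in simp_all)
qed

text \<open>The hypothesis on \<open>f\<close> supplies the decomposition of \<open>S\<close> into
  polytopes that a constant function also has to exhibit.\<close>

lemma pl_on_const:
  assumes "pl_on S f"
  shows "pl_on S (\<lambda>x. c)"
proof (rule pl_onE[OF assms])
  fix C
  assume C: "finite C" "\<And>c. c \<in> C \<Longrightarrow> polytope c" "\<Union>C = S"
  have "linear (\<lambda>x::'a. 0::'c)" by (rule linear_zero)
  then show ?thesis
    by (intro pl_onI[OF C] exI[of _ "\<lambda>x. 0"] exI[of _ c]) simp_all
qed

lemma pl_on_common_refinement:
  assumes "pl_on S f" "pl_on S g"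
  obtains C where "finite C" "\<And>c. c \<in> C \<Longrightarrow> polytope c" "\<Union>C = S"
    "\<And>c. c \<in> C \<Longrightarrow> \<exists>l a. linear l \<and> (\<forall>x\<in>c. f x = l x + a)"
    "\<And>c. c \<in> C \<Longrightarrow> \<exists>l a. linear l \<and> (\<forall>x\<in>c. g x = l x + a)"
proof -
  obtain C where C: "finite C" "\<And>c. c \<in> C \<Longrightarrow> polytope c" "\<Union>C = S"
    "\<And>c. c \<in> C \<Longrightarrow> \<exists>l a. linear l \<and> (\<forall>x\<in>c. f x = l x + a)"
    using pl_onE[OF assms(1)] by metis
  obtain D where D: "finite D" "\<And>c. c \<in> D \<Longrightarrow> polytope c" "\<Union>D = S"
    "\<And>c. c \<in> D \<Longrightarrow> \<exists>l a. linear l \<and> (\<forall>x\<in>c. g x = l x + a)"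
    using pl_onE[OF assms(2)] by metis
  let ?E = "(\<lambda>(c, d). c \<inter> d) ` (C \<times> D)"
  show ?thesis
  proof
    show "finite ?E" using C(1) D(1) by simp
    have "\<Union>?E = \<Union>C \<inter> \<Union>D" by auto
    then show "\<Union>?E = S" using C(3) D(3) by simp
  next
    fix e assume "e \<in> ?E"
    then obtain c d where e: "c \<in> C" "d \<in> D" "e = c \<inter> d" by auto
    show "polytope e" using e C(2) D(2) by (simp add: polytope_Int)
    obtain l a where "linear l" "\<forall>x\<in>c. f x = l x + a" using C(4)[OF e(1)] by blast
    then show "\<exists>l a. linear l \<and> (\<forall>x\<in>e. f x = l x + a)"
      unfolding e by (intro exI[of _ l] exI[of _ a]) simp
    obtain l a where "linear l" "\<forall>x\<in>d. g x = l x + a" using D(4)[OF e(2)] by blast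
    then show "\<exists>l a. linear l \<and> (\<forall>x\<in>e. g x = l x + a)"
      unfolding e by (intro exI[of _ l] exI[of _ a]) simp
  qed
qed

lemma pl_on_diff:
  assumes "pl_on S f" "pl_on S g"
  shows "pl_on S (\<lambda>x. f x - g x)"
proof (rule pl_on_common_refinement[OF assms])
  fix C
  assume C: "finite C" "\<And>c. c \<in> C \<Longrightarrow> polytope c" "\<Union>C = S"
    "\<And>c. c \<in> C \<Longrightarrow> \<exists>l a. linear l \<and> (\<forall>x\<in>c. f x = l x + a)"
    "\<And>c. c \<in> C \<Longrightarrow> \<exists>l a. linear l \<and> (\<forall>x\<in>c. g x = l x + a)"
  show ?thesis
  proof (rule pl_onI[OF C(1-3)])
    fix c assume c: "c \<in> C"
    obtain l a where l: "linear l" "\<forall>x\<in>c. f x = l x + a" using C(4)[OF c] by (elim exE conjE)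
    obtain l' a' where l': "linear l'" "\<forall>x\<in>c. g x = l' x + a'" using C(5)[OF c] by (elim exE conjE)
    have "linear (\<lambda>x. l x - l' x)" using l(1) l'(1) by (rule linear_compose_sub)
    moreover have "\<forall>x\<in>c. f x - g x = (l x - l' x) + (a - a')" using l(2) l'(2) by simp
    ultimately have "linear (\<lambda>x. l x - l' x) \<and> (\<forall>x\<in>c. f x - g x = (l x - l' x) + (a - a'))"
      by (rule conjI)
    then show "\<exists>l a. linear l \<and> (\<forall>x\<in>c. f x - g x = l x + a)"
      by (intro exI[of _ "\<lambda>x. l x - l' x"] exI[of _ "a - a'"])
  qed
qed

lemma pl_on_cmult:
  fixes f :: "'a::euclidean_space \<Rightarrow> real"
  assumes "pl_on S f"
  shows "pl_on S (\<lambda>x. r * f x)"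
proof (rule pl_onE[OF assms])
  fix C
  assume C: "finite C" "\<And>c. c \<in> C \<Longrightarrow> polytope c" "\<Union>C = S"
    "\<And>c. c \<in> C \<Longrightarrow> \<exists>l a. linear l \<and> (\<forall>x\<in>c. f x = l x + a)"
  show ?thesis
  proof (rule pl_onI[OF C(1-3)])
    fix c assume c: "c \<in> C"
    obtain l a where l: "linear l" "\<forall>x\<in>c. f x = l x + a" using C(4)[OF c] by (elim exE conjE)
    have "linear (\<lambda>x. r * l x)"
      using linear_compose_scale_right[OF l(1), of r] by simp
    moreover have "\<forall>x\<in>c. r * f x = r * l x + r * a" using l(2) by (simp add: algebra_simps)
    ultimately have "linear (\<lambda>x. r * l x) \<and> (\<forall>x\<in>c. r * f x = r * l x + r * a)"
      by (rule conjI)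
    then show "\<exists>l a. linear l \<and> (\<forall>x\<in>c. r * f x = l x + a)"
      by (intro exI[of _ "\<lambda>x. r * l x"] exI[of _ "r * a"])
  qed
qed

lemma linear_real_sublevel_halfspace:
  fixes l :: "'a::euclidean_space \<Rightarrow> real"
  assumes "linear l"
  shows "polyhedron {x. l x \<le> r}"
proof -
  \<comment> \<open>The Riesz vector of \<open>l\<close>: the sublevel set is a halfspace with
    normal \<open>w\<close>.\<close>
  define w where "w = (\<Sum>b\<in>Basis. l b *\<^sub>R b)"
  have "w \<bullet> x = l x" for x
  proof -
    have "l x = l (\<Sum>b\<in>Basis. (x \<bullet> b) *\<^sub>R b)"
      unfolding euclidean_representation ..
    also have "\<dots> = (\<Sum>b\<in>Basis. (x \<bullet> b) * l b)"
      using assms by (simp add: linear_sum linear_scale)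
    also have "\<dots> = w \<bullet> x"
      unfolding w_def inner_sum_left by (intro sum.cong) (simp_all add: inner_commute)
    finally show ?thesis by (rule sym)
  qed
  then show ?thesis using polyhedron_halfspace_le[of w r] by simp
qed

text \<open>Each polytope of a common refinement is cut along the set where the two affine pieces
  agree. Both parts are again polytopes, possibly empty, and on each of them the maximum is one of
  the two pieces.\<close>

lemma pl_on_max:
  fixes f g :: "'a::euclidean_space \<Rightarrow> real"
  assumes "pl_on S f" "pl_on S g"
  shows "pl_on S (\<lambda>x. max (f x) (g x))"
proof (rule pl_on_common_refinement[OF assms])
  fix C
  assume C: "finite C" "\<And>c. c \<in> C \<Longrightarrow> polytope c" "\<Union>C = S"
    "\<And>c. c \<in> C \<Longrightarrow> \<exists>l a. linear l \<and> (\<forall>x\<in>c. f x = l x + a)"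
    "\<And>c. c \<in> C \<Longrightarrow> \<exists>l a. linear l \<and> (\<forall>x\<in>c. g x = l x + a)"
  let ?U = "\<lambda>c. {x\<in>c. f x \<le> g x}" and ?V = "\<lambda>c. {x\<in>c. g x \<le> f x}"
  have half: "polytope {x\<in>c. u x \<le> v x}"
    if c: "c \<in> C" and u: "linear l" "\<forall>x\<in>c. u x = l x + a" and v: "linear l'" "\<forall>x\<in>c. v x = l' x + a'"
    for c u v a a' and l l' :: "'a \<Rightarrow> real"
  proof -
    have "linear (\<lambda>x. l x - l' x)" using u(1) v(1) by (rule linear_compose_sub)
    from linear_real_sublevel_halfspace[OF this, of "a' - a"]
    have "polytope (c \<inter> {x. l x - l' x \<le> a' - a})"
      using C(2)[OF c] by (simp add: polytope_Int_polyhedron)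
    moreover have "c \<inter> {x. l x - l' x \<le> a' - a} = {x\<in>c. u x \<le> v x}"
      using u(2) v(2) by auto
    ultimately show ?thesis by simp
  qed
  show ?thesis
  proof (rule pl_onI)
    show "finite (?U ` C \<union> ?V ` C)" using C(1) by simp
    have "\<Union>(?U ` C \<union> ?V ` C) = (\<Union>c\<in>C. ?U c \<union> ?V c)"
      by (simp only: Union_Un_distrib UN_Un_distrib)
    also have "\<dots> = (\<Union>c\<in>C. c)"
      by (rule SUP_cong) (auto simp: linorder_linear)
    also have "\<dots> = S" using C(3) by simp
    finally show "\<Union>(?U ` C \<union> ?V ` C) = S" .
  next
    fix e assume "e \<in> ?U ` C \<union> ?V ` C"
    then obtain c where c: "c \<in> C" "e = ?U c \<or> e = ?V c" by auto
    obtain l a where l: "linear l" "\<forall>x\<in>c. f x = l x + a" using C(4)[OF c(1)] by (elim exE conjE)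
    obtain l' a' where l': "linear l'" "\<forall>x\<in>c. g x = l' x + a'" using C(5)[OF c(1)] by (elim exE conjE)
    have U: "max (f x) (g x) = l' x + a'" if "x \<in> ?U c" for x
    proof -
      have "x \<in> c" "f x \<le> g x" using that by simp_all
      then have "g x = l' x + a'" "max (f x) (g x) = g x" using l'(2) by simp_all
      then show ?thesis by (simp only:)
    qed
    have V: "max (f x) (g x) = l x + a" if "x \<in> ?V c" for x
    proof -
      have "x \<in> c" "g x \<le> f x" using that by simp_all
      then have "f x = l x + a" "max (f x) (g x) = f x" using l(2) by simp_all
      then show ?thesis by (simp only:)
    qed
    from c(2) show "polytope e"
      by (elim disjE; simp only: half[OF c(1) l l'] half[OF c(1) l' l])
    from c(2) show "\<exists>l a. linear l \<and> (\<forall>x\<in>e. max (f x) (g x) = l x + a)"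
    proof
      assume "e = ?U c"
      then have "\<forall>x\<in>e. max (f x) (g x) = l' x + a'" using U by (intro ballI) simp
      with l'(1) have "linear l' \<and> (\<forall>x\<in>e. max (f x) (g x) = l' x + a')" by (rule conjI)
      then show ?thesis by (intro exI[of _ l'] exI[of _ a'])
    next
      assume "e = ?V c"
      then have "\<forall>x\<in>e. max (f x) (g x) = l x + a" using V by (intro ballI) simp
      with l(1) have "linear l \<and> (\<forall>x\<in>e. max (f x) (g x) = l x + a)" by (rule conjI)
      then show ?thesis by (intro exI[of _ l] exI[of _ a])
    qed
  qed
qed

lemma pl_on_Max:
  fixes f :: "'i \<Rightarrow> 'a::euclidean_space \<Rightarrow> real"
  assumes "finite I" "I \<noteq> {}" "\<And>i. i \<in> I \<Longrightarrow> pl_on S (f i)"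
  shows "pl_on S (\<lambda>x. Max ((\<lambda>i. f i x) ` I))"
  using assms
proof (induction I rule: finite_ne_induct)
  case (insert i I)
  have f: "pl_on S (f i)" and m: "pl_on S (\<lambda>x. Max ((\<lambda>i. f i x) ` I))"
    using insert by auto
  have "Max ((\<lambda>i. f i x) ` insert i I) = max (f i x) (Max ((\<lambda>i. f i x) ` I))" for x
    using insert.hyps by simp
  then show ?case
    using pl_on_max[OF f m] by (simp only:)
qed simp

lemma pl_on_Min:
  fixes f :: "'i \<Rightarrow> 'a::euclidean_space \<Rightarrow> real"
  assumes "finite I" "I \<noteq> {}" "\<And>i. i \<in> I \<Longrightarrow> pl_on S (f i)"
  shows "pl_on S (\<lambda>x. Min ((\<lambda>i. f i x) ` I))"
proof -
  have "pl_on S (\<lambda>x. - 1 * Max ((\<lambda>i. - 1 * f i x) ` I))"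
    by (rule pl_on_cmult, rule pl_on_Max[OF assms(1,2)], rule pl_on_cmult, rule assms(3))
  moreover have "Min ((\<lambda>i. f i x) ` I) = - 1 * Max ((\<lambda>i. - 1 * f i x) ` I)" for x
    using assms(1,2) minus_Max_eq_Min[of "(\<lambda>i. - f i x) ` I"] by (simp add: image_image)
  ultimately show ?thesis by (simp only:)
qed

lemma pl_on_imp_compact:
  assumes "pl_on S f"
  shows "compact S"
proof (rule pl_onE[OF assms])
  fix C
  assume C: "finite C" "\<And>c. c \<in> C \<Longrightarrow> polytope c" "\<Union>C = S"
  show "compact S"
    unfolding C(3)[symmetric] by (intro compact_Union polytope_imp_compact C(1,2))
qed

lemma pl_on_imp_continuous_on:
  assumes "pl_on S f"
  shows "continuous_on S f"
proof (rule pl_onE[OF assms])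
  fix C
  assume C: "finite C" "\<And>c. c \<in> C \<Longrightarrow> polytope c" "\<Union>C = S"
    "\<And>c. c \<in> C \<Longrightarrow> \<exists>l a. linear l \<and> (\<forall>x\<in>c. f x = l x + a)"
  have "continuous_on (\<Union>c\<in>C. c) f"
  proof (rule continuous_on_closed_Union[OF C(1)])
    fix c assume c: "c \<in> C"
    show "closed c" using C(2)[OF c] by (rule polytope_imp_closed)
    obtain l a where l: "linear l" "\<forall>x\<in>c. f x = l x + a" using C(4)[OF c] by (elim exE conjE)
    have "continuous_on c (\<lambda>x. l x + a)"
      using l(1) by (intro continuous_on_add continuous_on_const linear_continuous_on)
        (simp add: linear_conv_bounded_linear)
    then show "continuous_on c f"
      by (rule continuous_on_eq) (use l(2) in simp)
  qed
  then show "continuous_on S f" using C(3) by simp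
qed

section \<open>Layer decompositions along chains of sets\<close>

lemma finite_chain_Union_mem:
  assumes "finite C" "C \<noteq> {}" "chain_subset C"
  shows "\<Union>C \<in> C"
  using assms
proof (induction C rule: finite_ne_induct)
  case (insert s C)
  then have "\<Union>C \<in> C" by (auto simp: chain_subset_def)
  with insert.prems have "s \<subseteq> \<Union>C \<or> \<Union>C \<subseteq> s" by (auto simp: chain_subset_def)
  then show ?case using \<open>\<Union>C \<in> C\<close> by (auto simp: Un_absorb1 Un_absorb2)
qed simp

lemma finite_chain_Inter_mem:
  assumes "finite C" "C \<noteq> {}" "chain_subset C"
  shows "\<Inter>C \<in> C"
  using assms
proof (induction C rule: finite_ne_induct)
  case (insert s C)
  then have "\<Inter>C \<in> C" by (auto simp: chain_subset_def)
  with insert.prems have "s \<subseteq> \<Inter>C \<or> \<Inter>C \<subseteq> s" by (meson chain_subset_def insertI1 insertI2)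
  then show ?case using \<open>\<Inter>C \<in> C\<close> by (auto simp: Int_absorb1 Int_absorb2)
qed simp

text \<open>Layer-cake argument: the least value \<open>m\<close> on the support \<open>S\<close> is
  subtracted from all of \<open>S\<close>. A point where it is attained leaves the support, so the
  induction hypothesis applies to the remainder, and \<open>S\<close> with weight \<open>m\<close>
  is put on top of its chain.\<close>

lemma chain_layer_decomposition:
  fixes w :: "'v \<Rightarrow> real"
  assumes "finite S" "\<And>v. 0 \<le> w v" "{v. w v \<noteq> 0} = S"
  shows "\<exists>C c. finite C \<and> chain_subset C \<and> (\<forall>t\<in>C. t \<subseteq> S \<and> t \<noteq> {} \<and> 0 < c t) \<and>
           (\<forall>v. w v = (\<Sum>t | t \<in> C \<and> v \<in> t. c t))"
  using assms
proof (induction S arbitrary: w rule: finite_psubset_induct)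
  case (psubset S w)
  show ?case
  proof (cases "S = {}")
    case True
    then have "w v = 0" for v using psubset.prems(2) by blast
    then show ?thesis
      by (intro exI[of _ "{}"] exI[of _ "\<lambda>_. 0"]) (simp add: chain_subset_def)
  next
    case False
    define m where "m = Min (w ` S)"
    have m_le: "m \<le> w v" if "v \<in> S" for v
      using that psubset.hyps by (simp add: m_def)
    have "m \<in> w ` S" unfolding m_def using False psubset.hyps by (intro Min_in) auto
    then obtain v0 where v0: "v0 \<in> S" "w v0 = m" by auto
    have m_pos: "m > 0"
    proof -
      have "w v0 \<noteq> 0" using v0(1) psubset.prems(2) by blast
      then show ?thesis using psubset.prems(1)[of v0] v0(2) by linarith
    qed
    define w' where "w' = (\<lambda>v. if v \<in> S then w v - m else 0)"
    define S' where "S' = {v. w' v \<noteq> 0}"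
    have S': "S' \<subset> S" unfolding S'_def w'_def using v0 by auto
    obtain C c where C: "finite C" "chain_subset C" "\<forall>t\<in>C. t \<subseteq> S' \<and> t \<noteq> {} \<and> 0 < c t"
      "\<forall>v. w' v = (\<Sum>t | t \<in> C \<and> v \<in> t. c t)"
    proof -
      have "\<And>v. 0 \<le> w' v" using m_le by (simp add: w'_def)
      from psubset.IH[OF S' this S'_def[symmetric]] show ?thesis
        by (elim exE conjE) (rule that)
    qed
    \<comment> \<open>The layers of the remainder are proper subsets of \<open>S\<close>, so setting
      the weight of \<open>S\<close> overwrites none of theirs.\<close>
    have SC: "S \<notin> C" using C(3) S' by blast
    let ?c = "c(S := m)"
    have "w v = (\<Sum>t | t \<in> insert S C \<and> v \<in> t. ?c t)" for v
    proof -
      have eq: "(\<Sum>t | t \<in> C \<and> v \<in> t. ?c t) = w' v"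
        using C(4) SC by (auto intro!: sum.cong)
      show ?thesis
      proof (cases "v \<in> S")
        case True
        then have "{t. t \<in> insert S C \<and> v \<in> t} = insert S {t. t \<in> C \<and> v \<in> t}" by auto
        then show ?thesis using eq C(1) SC True by (simp add: w'_def)
      next
        case False
        then have "{t. t \<in> insert S C \<and> v \<in> t} = {t. t \<in> C \<and> v \<in> t}" by auto
        moreover have "w v = 0" using False psubset.prems by blast
        ultimately show ?thesis using eq False by (simp add: w'_def)
      qed
    qed
    moreover have "chain_subset (insert S C)"
    proof -
      have "t \<subseteq> S" if "t \<in> C" for t using that C(3) S' by auto
      then show ?thesis using C(2) unfolding chain_subset_def by auto
    qed
    moreover have "\<forall>t\<in>insert S C. t \<subseteq> S \<and> t \<noteq> {} \<and> 0 < ?c t"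
      using C(3) S' SC False m_pos by auto
    moreover have "finite (insert S C)" using C(1) by simp
    ultimately have "finite (insert S C) \<and> chain_subset (insert S C) \<and>
        (\<forall>t\<in>insert S C. t \<subseteq> S \<and> t \<noteq> {} \<and> 0 < ?c t) \<and>
        (\<forall>v. w v = (\<Sum>t | t \<in> insert S C \<and> v \<in> t. ?c t))"
      by (intro conjI allI)
    then show ?thesis by (intro exI[of _ "insert S C"] exI[of _ ?c])
  qed
qed

text \<open>The \<open>0\<close> in the maximum stands for the values outside \<open>V\<close>, and covers \<open>s = V\<close>.\<close>

definition gap :: "'v set \<Rightarrow> ('v \<Rightarrow> real) \<Rightarrow> 'v set \<Rightarrow> real" where
  "gap V w s = max 0 (Min (w ` s) - Max (insert 0 (w ` (V - s))))"

text \<open>Every layer containing \<open>s\<close> contributes to all values on \<open>s\<close>,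
  and the layers properly containing \<open>s\<close> account for the largest value off
  \<open>s\<close>; the difference is the weight of \<open>s\<close> itself. The coefficients of a
  layer decomposition are thus determined by \<open>w\<close>, and \<open>gap\<close> computes
  them.\<close>

lemma gap_chain:
  fixes w :: "'v \<Rightarrow> real"
  assumes V: "finite V" and C: "finite C" "chain_subset C" "\<And>t. t \<in> C \<Longrightarrow> t \<subseteq> V"
    and c: "\<And>t. t \<in> C \<Longrightarrow> 0 \<le> c t"
    and w: "\<And>v. w v = (\<Sum>t | t \<in> C \<and> v \<in> t. c t)"
    and s: "s \<subseteq> V" "s \<noteq> {}"
  shows "gap V w s = (if s \<in> C then c s else 0)"
proof -
  have fs: "finite s" using V s finite_subset by blast
  have mono: "(\<Sum>t\<in>P. c t) \<le> (\<Sum>t\<in>Q. c t)" if "P \<subseteq> Q" "Q \<subseteq> C" for P Q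
    using that C c by (intro sum_mono2) (auto intro: finite_subset)
  show ?thesis
  proof (cases "\<forall>t\<in>C. t \<subseteq> s \<or> s \<subseteq> t")
    case False
    \<comment> \<open>A layer \<open>t1\<close> not comparable with \<open>s\<close> closes the gap:
      by the chain property every layer through \<open>a\<close> contains \<open>t1\<close>, hence
      also \<open>b\<close>.\<close>
    then obtain t1 a b where t1: "t1 \<in> C" "a \<in> s" "a \<notin> t1" "b \<in> t1" "b \<notin> s" by blast
    have "w a \<le> w b" unfolding w
      by (rule mono) (use t1 C(2) in \<open>auto simp: chain_subset_def\<close>)
    moreover have "Min (w ` s) \<le> w a" using t1 fs by simp
    moreover have "w b \<le> Max (insert 0 (w ` (V - s)))" using t1 V C(3) by (intro Max_ge) auto
    moreover have "s \<notin> C" using t1 C(2) by (auto simp: chain_subset_def)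
    ultimately show ?thesis unfolding gap_def by auto
  next
    case True
    let ?D = "{t\<in>C. t \<subset> s}" and ?E = "{t\<in>C. s \<subset> t}" and ?E' = "{t\<in>C. s \<subseteq> t}"
    have "\<Union>?D \<subset> s"
    proof (cases "?D = {}")
      case False
      have "\<Union>?D \<in> ?D"
        by (rule finite_chain_Union_mem) (use C False in \<open>auto simp: chain_subset_def\<close>)
      then show ?thesis by blast
    qed (use s in auto)
    \<comment> \<open>The layers strictly inside \<open>s\<close> do not cover \<open>s\<close>, as
      their union is the largest of them. At a point \<open>v\<close> that they miss, only the
      layers containing \<open>s\<close> count, so the minimum is attained there.\<close>
    then obtain v where v: "v \<in> s" "v \<notin> \<Union>?D" by blast
    have "{t. t \<in> C \<and> v \<in> t} = ?E'" using v True by blast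
    then have wv: "w v = sum c ?E'" using w by metis
    have min: "Min (w ` s) = sum c ?E'"
    proof (rule Min_eqI)
      show "finite (w ` s)" using fs by simp
      show "sum c ?E' \<in> w ` s" using wv v by (metis imageI)
      fix y assume "y \<in> w ` s"
      then obtain u where u: "u \<in> s" "y = w u" by auto
      show "sum c ?E' \<le> y" unfolding u(2) w by (rule mono) (use u in auto)
    qed
    have max: "Max (insert 0 (w ` (V - s))) = sum c ?E"
    proof (rule Max_eqI)
      show "finite (insert 0 (w ` (V - s)))" using V by simp
      fix y assume "y \<in> insert 0 (w ` (V - s))"
      then consider "y = 0" | u where "u \<in> V - s" "y = w u" by auto
      then show "y \<le> sum c ?E"
      proof cases
        case 1 then show ?thesis using c by (auto intro: sum_nonneg)
      next
        case 2
        show ?thesis unfolding 2 w by (rule mono) (use 2 True in auto)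
      qed
    next
      show "sum c ?E \<in> insert 0 (w ` (V - s))"
      proof (cases "?E = {}")
        case True
        show ?thesis unfolding True by simp
      next
        case False
        \<comment> \<open>The smallest layer properly containing \<open>s\<close> has a point off
          \<open>s\<close>. It lies in exactly the layers properly containing \<open>s\<close>, so
          the maximum is attained there. In the case without such layers the inserted 0 is the
          maximum.\<close>
        have E: "\<Inter>?E \<in> ?E"
          by (rule finite_chain_Inter_mem) (use C False in \<open>auto simp: chain_subset_def\<close>)
        then obtain u where u: "u \<in> \<Inter>?E" "u \<notin> s" by blast
        then have "{t. t \<in> C \<and> u \<in> t} = ?E" using True by blast
        then have "w u = sum c ?E" using w by metis
        moreover have "\<Inter>?E \<in> C" using E by simp
        from C(3)[OF this] u(1) have "u \<in> V" by (rule subsetD)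
        then have "w u \<in> w ` (V - s)" using u(2) by simp
        ultimately show ?thesis by simp
      qed
    qed
    have "sum c ?E' = (if s \<in> C then c s else 0) + sum c ?E"
    proof (cases "s \<in> C")
      case True
      then have "?E' = insert s ?E" by auto
      moreover have "sum c (insert s ?E) = c s + sum c ?E" using C(1) by simp
      ultimately show ?thesis using True by (simp only: if_True)
    next
      case False
      then have "?E' = ?E" by auto
      then show ?thesis using False by (simp only: if_False add_0)
    qed
    then show ?thesis unfolding gap_def min max using c[of s] by simp
  qed
qed

lemma sum_chain_layers:
  fixes c \<phi> :: "_ \<Rightarrow> real"
  assumes "finite V" "finite C" "\<And>t. t \<in> C \<Longrightarrow> t \<subseteq> V"
  shows "(\<Sum>v\<in>V. (\<Sum>t | t \<in> C \<and> v \<in> t. c t) * \<phi> v) = (\<Sum>t\<in>C. c t * (\<Sum>v\<in>t. \<phi> v))"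
proof -
  have "(\<Sum>v\<in>V. (\<Sum>t | t \<in> C \<and> v \<in> t. c t) * \<phi> v) = (\<Sum>v\<in>V. \<Sum>t\<in>C. if v \<in> t then c t * \<phi> v else 0)"
    using assms by (auto simp: sum_distrib_right sum.inter_filter intro!: sum.cong)
  also have "\<dots> = (\<Sum>t\<in>C. \<Sum>v\<in>V. if v \<in> t then c t * \<phi> v else 0)" by (rule sum.swap)
  also have "\<dots> = (\<Sum>t\<in>C. c t * (\<Sum>v\<in>t. \<phi> v))"
  proof (rule sum.cong)
    fix t assume t: "t \<in> C"
    have "(\<Sum>v\<in>V. if v \<in> t then c t * \<phi> v else 0) = (\<Sum>v\<in>{v\<in>V. v \<in> t}. c t * \<phi> v)"
      using assms(1) by (rule sum.inter_filter[symmetric])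
    moreover have "{v\<in>V. v \<in> t} = t" using assms(3)[OF t] by auto
    ultimately show "(\<Sum>v\<in>V. if v \<in> t then c t * \<phi> v else 0) = c t * (\<Sum>v\<in>t. \<phi> v)"
      by (simp add: sum_distrib_left)
  qed simp
  finally show ?thesis .
qed

text \<open>The difference of the means is the average of \<phi> a - \<phi> b over all pairs from
  \<open>s\<close> and \<open>t\<close>. Since \<open>s\<close> lies in \<open>t\<close>, for each
  \<open>a\<close> one of the \<open>card t\<close> terms is zero, which yields the contraction
  factor of barycentric subdivision.\<close>

lemma mean_diff_le:
  fixes \<phi> :: "'v \<Rightarrow> real"
  assumes t: "finite t" and s: "s \<subseteq> t" "s \<noteq> {}"
    and le: "\<And>u v. u \<in> t \<Longrightarrow> v \<in> t \<Longrightarrow> \<bar>\<phi> u - \<phi> v\<bar> \<le> \<epsilon>"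
  shows "\<bar>(\<Sum>v\<in>s. \<phi> v) / real (card s) - (\<Sum>v\<in>t. \<phi> v) / real (card t)\<bar> \<le> (1 - 1 / real (card t)) * \<epsilon>"
proof -
  have fs: "finite s" using t s(1) finite_subset by metis
  have pos: "0 < card s" "0 < card t" using fs s t by (auto simp: card_gt_0_iff)
  let ?d = "\<Sum>a\<in>s. \<Sum>b\<in>t. \<phi> a - \<phi> b"
  have "?d = real (card t) * (\<Sum>v\<in>s. \<phi> v) - real (card s) * (\<Sum>v\<in>t. \<phi> v)"
    by (simp add: sum_subtractf sum_distrib_left)
  then have "(\<Sum>v\<in>s. \<phi> v) / real (card s) - (\<Sum>v\<in>t. \<phi> v) / real (card t)
      = ?d / (real (card s) * real (card t))"
    using pos by (simp add: field_simps)
  moreover have d_le: "\<bar>?d\<bar> \<le> real (card s) * ((real (card t) - 1) * \<epsilon>)"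
  proof -
    have "\<bar>?d\<bar> \<le> (\<Sum>a\<in>s. \<bar>\<Sum>b\<in>t. \<phi> a - \<phi> b\<bar>)" by (rule sum_abs)
    also have "\<dots> \<le> (\<Sum>a\<in>s. (real (card t) - 1) * \<epsilon>)"
    proof (rule sum_mono)
      fix a assume a: "a \<in> s"
      then have at: "a \<in> t" using s by auto
      \<comment> \<open>The diagonal term \<open>b = a\<close> vanishes.\<close>
      have "(\<Sum>b\<in>t. \<phi> a - \<phi> b) = (\<Sum>b\<in>t - {a}. \<phi> a - \<phi> b)"
        using sum.remove[OF t at, of "\<lambda>b. \<phi> a - \<phi> b"] by simp
      then have "\<bar>\<Sum>b\<in>t. \<phi> a - \<phi> b\<bar> \<le> (\<Sum>b\<in>t - {a}. \<bar>\<phi> a - \<phi> b\<bar>)"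
        using sum_abs[of "\<lambda>b. \<phi> a - \<phi> b" "t - {a}"] by simp
      also have "\<dots> \<le> (\<Sum>b\<in>t - {a}. \<epsilon>)" by (rule sum_mono) (use le at in auto)
      also have "\<dots> = (real (card t) - 1) * \<epsilon>"
        using t at pos by (simp add: card_Diff_singleton of_nat_diff)
      finally show "\<bar>\<Sum>b\<in>t. \<phi> a - \<phi> b\<bar> \<le> (real (card t) - 1) * \<epsilon>" .
    qed
    finally show ?thesis by simp
  qed
  ultimately have "\<bar>(\<Sum>v\<in>s. \<phi> v) / real (card s) - (\<Sum>v\<in>t. \<phi> v) / real (card t)\<bar>
      = \<bar>?d\<bar> / (real (card s) * real (card t))"
    by (simp only: abs_divide abs_mult abs_of_nat)
  also have "\<dots> \<le> real (card s) * ((real (card t) - 1) * \<epsilon>) / (real (card s) * real (card t))"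
    by (rule divide_right_mono[OF d_le]) simp
  also have "\<dots> = (1 - 1 / real (card t)) * \<epsilon>"
    using pos by (simp add: field_simps)
  finally show ?thesis .
qed

section \<open>Barycentric subdivision\<close>

definition uniform_weight :: "'v set \<Rightarrow> 'v \<Rightarrow> real" where
  "uniform_weight s v = (if v \<in> s then 1 / real (card s) else 0)"

text \<open>Vertices are points of \<open>M\<close>, so \<open>\<phi>\<close> can be evaluated at
  them directly. This lets one function be followed through a sequence of subdivisions whose vertex
  sets differ.\<close>

definition simplexwise_affine ::
  "'a set \<Rightarrow> 'a set set \<Rightarrow> ('a \<Rightarrow> 'a \<Rightarrow> real) \<Rightarrow> ('a \<Rightarrow> real) \<Rightarrow> bool" where
  "simplexwise_affine M K \<beta> \<phi> \<longleftrightarrow> (\<forall>x\<in>M. \<phi> x = (\<Sum>v\<in>\<Union>K. \<beta> x v * \<phi> v))"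

text \<open>Takes the place of the mesh of a triangulation, relative to a test function.\<close>

definition oscillation_le :: "'a set set \<Rightarrow> ('a \<Rightarrow> real) \<Rightarrow> real \<Rightarrow> bool" where
  "oscillation_le K \<phi> \<epsilon> \<longleftrightarrow> (\<forall>s\<in>K. \<forall>u\<in>s. \<forall>v\<in>s. \<bar>\<phi> u - \<phi> v\<bar> \<le> \<epsilon>)"

section \<open>Triangulations and their coordinate functions\<close>

locale triangulated =
  fixes M :: "'a::euclidean_space set" and K :: "'a set set" and \<beta> :: "'a \<Rightarrow> 'a \<Rightarrow> real"
  assumes triangulation: "pl_triangulation M K \<beta>"
begin

lemma complex: "abstract_complex K"
  and vertices_subset: "\<Union>K \<subseteq> M"
  and coord_homeomorphism: "\<exists>h. homeomorphism M (realization K) \<beta> h"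
  using triangulation unfolding pl_triangulation_def by simp_all

lemma finite_complex: "finite K"
  using complex unfolding abstract_complex_def by (elim conjE)

lemma finite_simplex: "s \<in> K \<Longrightarrow> finite s"
  and simplex_nonempty: "s \<in> K \<Longrightarrow> s \<noteq> {}"
proof -
  have *: "\<forall>s\<in>K. finite s \<and> s \<noteq> {}"
    using complex unfolding abstract_complex_def by (elim conjE)
  show "finite s" "s \<noteq> {}" if "s \<in> K"
    using bspec[OF * that] by simp_all
qed

lemma face_closed:
  assumes "s \<in> K" "t \<subseteq> s" "t \<noteq> {}"
  shows "t \<in> K"
proof -
  have "\<forall>s\<in>K. \<forall>t. t \<subseteq> s \<and> t \<noteq> {} \<longrightarrow> t \<in> K"
    using complex unfolding abstract_complex_def by (elim conjE)
  from bspec[OF this assms(1)] show ?thesis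
    using assms(2,3) by (elim allE[of _ t]) simp
qed

lemma finite_vertices: "finite (\<Union>K)"
  using finite_complex finite_simplex by simp

lemma card_simplex_pos: "s \<in> K \<Longrightarrow> 0 < card s"
  using finite_simplex simplex_nonempty by (simp add: card_gt_0_iff)

lemma coord_vertex:
  assumes "v \<in> \<Union>K"
  shows "\<beta> v = (\<lambda>u. if u = v then 1 else 0)"
proof -
  have "\<forall>v\<in>\<Union>K. \<beta> v = (\<lambda>u. if u = v then 1 else 0)"
    using triangulation unfolding pl_triangulation_def by (elim conjE)
  then show ?thesis using assms by (rule bspec)
qed

lemma coord_pl:
  assumes "v \<in> \<Union>K"
  shows "pl_on M (\<lambda>x. \<beta> x v)"
proof -
  have "\<forall>v\<in>\<Union>K. pl_on M (\<lambda>x. \<beta> x v)"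
    using triangulation unfolding pl_triangulation_def by (elim conjE)
  then show ?thesis using assms by (rule bspec)
qed

lemma coord_image: "\<beta> ` M = realization K"
  and coord_inj: "inj_on \<beta> M"
  and continuous_on_coords: "continuous_on M \<beta>"
proof -
  obtain h where h: "homeomorphism M (realization K) \<beta> h"
    using coord_homeomorphism by (elim exE)
  show "\<beta> ` M = realization K" using h by (rule homeomorphism_image1)
  show "continuous_on M \<beta>" using h by (rule homeomorphism_cont1)
  show "inj_on \<beta> M" by (rule inj_on_inverseI[of _ h]) (rule homeomorphism_apply1[OF h])
qed

lemma coord_realization: "x \<in> M \<Longrightarrow> \<beta> x \<in> realization K"
  using coord_image by auto

lemma coord_nonneg: "x \<in> M \<Longrightarrow> 0 \<le> \<beta> x v"
  and coord_support: "x \<in> M \<Longrightarrow> {v. \<beta> x v \<noteq> 0} \<in> K"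
  and coord_sum: "x \<in> M \<Longrightarrow> (\<Sum>v\<in>\<Union>K. \<beta> x v) = 1"
  using coord_realization[of x] unfolding realization_def mem_Collect_eq by simp_all

lemma coord_outside: "x \<in> M \<Longrightarrow> v \<notin> \<Union>K \<Longrightarrow> \<beta> x v = 0"
  using coord_support[of x] by auto

lemma continuous_on_coord: "continuous_on M (\<lambda>x. \<beta> x v)"
  by (rule continuous_on_product_then_coordinatewise[OF continuous_on_coords])

text \<open>Each coordinate function comes with a finite decomposition of \<open>M\<close> into
  polytopes. If there are no vertices, \<open>M\<close> is empty, because the coordinates of a point
  sum to 1.\<close>

lemma compact_carrier: "compact M"
proof (cases "\<Union>K = {}")
  case True
  have "x \<notin> M" for x using coord_sum[of x] unfolding True by auto
  then have "M = {}" by auto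
  then show ?thesis by simp
next
  case False
  then obtain v where "v \<in> \<Union>K" by auto
  then show ?thesis by (intro pl_on_imp_compact[OF coord_pl])
qed

text \<open>Defined through the coordinates, since an average in the ambient space need not lie in
  \<open>M\<close>.\<close>

definition barycentre :: "'a set \<Rightarrow> 'a" where
  "barycentre s = inv_into M \<beta> (uniform_weight s)"

lemma uniform_weight_realization:
  assumes s: "s \<in> K"
  shows "uniform_weight s \<in> realization K"
proof -
  have "{v. uniform_weight s v \<noteq> 0} = s"
    using card_simplex_pos[OF s] by (auto simp: uniform_weight_def)
  moreover have "(\<Sum>v\<in>\<Union>K. uniform_weight s v) = (\<Sum>v\<in>s. 1 / real (card s))"
  proof -
    have "\<Union>K \<inter> s = s" using s by auto
    then show ?thesis
      unfolding uniform_weight_def sum.inter_restrict[OF finite_vertices, symmetric] by (simp only:)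
  qed
  moreover have "(\<Sum>v\<in>s. 1 / real (card s)) = 1" using card_simplex_pos[OF s] by simp
  moreover have "0 \<le> uniform_weight s v" for v unfolding uniform_weight_def by simp
  ultimately show ?thesis
    using s unfolding realization_def mem_Collect_eq by (simp only: simp_thms)
qed

lemma barycentre_in: "s \<in> K \<Longrightarrow> barycentre s \<in> M"
  and coord_barycentre: "s \<in> K \<Longrightarrow> \<beta> (barycentre s) = uniform_weight s"
  unfolding barycentre_def using uniform_weight_realization[of s]
  by (simp_all only: coord_image[symmetric] inv_into_into f_inv_into_f)

lemma barycentre_inj: "inj_on barycentre K"
proof (rule inj_onI)
  fix s t assume st: "s \<in> K" "t \<in> K" "barycentre s = barycentre t"
  then have "uniform_weight s = uniform_weight t"
    using coord_barycentre[of s] coord_barycentre[of t] by simp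
  moreover have "{v. uniform_weight r v \<noteq> 0} = r" if "r \<in> K" for r
    using card_simplex_pos[OF that] by (auto simp: uniform_weight_def)
  ultimately show "s = t" using st(1,2) by metis
qed

lemma coord_layers:
  assumes x: "x \<in> M"
  obtains C c where "C \<noteq> {}" "C \<subseteq> K" "chain_subset C" "\<And>t. t \<in> C \<Longrightarrow> 0 < c t"
    "\<And>v. \<beta> x v = (\<Sum>t | t \<in> C \<and> v \<in> t. c t)"
proof -
  let ?S = "{v. \<beta> x v \<noteq> 0}"
  have S: "?S \<in> K" by (rule coord_support[OF x])
  obtain C c where C: "chain_subset C" "\<forall>t\<in>C. t \<subseteq> ?S \<and> t \<noteq> {} \<and> 0 < c t"
    "\<forall>v. \<beta> x v = (\<Sum>t | t \<in> C \<and> v \<in> t. c t)"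
    using chain_layer_decomposition[OF finite_simplex[OF S], of "\<beta> x", OF coord_nonneg[OF x] refl]
    by (elim exE conjE)
  show ?thesis
  proof (rule that[of C c])
    show "C \<subseteq> K" using C(2) face_closed[OF S] by auto
    show "C \<noteq> {}"
    proof
      assume "C = {}"
      then have "?S = {}" using C(3) by simp
      then show False using simplex_nonempty[OF S] by simp
    qed
  qed (use C in auto)
qed

lemma gap_layers:
  assumes C: "C \<subseteq> K" "chain_subset C" "\<And>t. t \<in> C \<Longrightarrow> 0 < c t"
    and w: "\<And>v. w v = (\<Sum>t | t \<in> C \<and> v \<in> t. c t)" and s: "s \<in> K"
  shows "gap (\<Union>K) w s = (if s \<in> C then c s else 0)"
proof (rule gap_chain[OF finite_vertices _ C(2) _ _ w])
  show "finite C" using C(1) finite_complex by (rule finite_subset)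
  show "t \<subseteq> \<Union>K" if "t \<in> C" for t using that C(1) by auto
  show "0 \<le> c t" if "t \<in> C" for t using C(3)[OF that] by simp
  show "s \<subseteq> \<Union>K" using s by auto
  show "s \<noteq> {}" using s by (rule simplex_nonempty)
qed

text \<open>Used for three choices of \<open>\<phi>\<close>: the constant 1 shows that the new
  coordinates sum to 1, the indicator of a vertex recovers the old coordinates, and a simplexwise
  affine function is seen to remain so after subdivision.\<close>

lemma sum_gap:
  assumes x: "x \<in> M"
  shows "(\<Sum>s\<in>K. gap (\<Union>K) (\<beta> x) s * (\<Sum>v\<in>s. \<phi> v)) = (\<Sum>v\<in>\<Union>K. \<beta> x v * \<phi> v)"
proof (rule coord_layers[OF x])
  fix C c
  assume C: "C \<subseteq> K" "chain_subset C" "\<And>t. t \<in> C \<Longrightarrow> 0 < c t"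
    and w: "\<And>v. \<beta> x v = (\<Sum>t | t \<in> C \<and> v \<in> t. c t)"
  have "(\<Sum>s\<in>K. gap (\<Union>K) (\<beta> x) s * (\<Sum>v\<in>s. \<phi> v))
      = (\<Sum>s\<in>K. if s \<in> C then c s * (\<Sum>v\<in>s. \<phi> v) else 0)"
    by (rule sum.cong) (simp_all add: gap_layers[OF C w])
  also have "\<dots> = (\<Sum>s\<in>C. c s * (\<Sum>v\<in>s. \<phi> v))"
    using C(1) finite_complex by (simp add: sum.inter_restrict[symmetric] Int_absorb1)
  also have "\<dots> = (\<Sum>v\<in>\<Union>K. (\<Sum>t | t \<in> C \<and> v \<in> t. c t) * \<phi> v)"
  proof (rule sum_chain_layers[symmetric, OF finite_vertices])
    show "finite C" using C(1) finite_complex by (rule finite_subset)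
    show "t \<subseteq> \<Union>K" if "t \<in> C" for t using that C(1) by auto
  qed
  finally show ?thesis unfolding w .
qed

text \<open>The order complex of the face poset of \<open>K\<close>. Each face is represented by its
  barycentre because the vertices of a triangulation have to be points of \<open>M\<close>.\<close>

definition sd_complex :: "'a set set" where
  "sd_complex = (\<lambda>C. barycentre ` C) ` {C. C \<subseteq> K \<and> C \<noteq> {} \<and> chain_subset C}"

text \<open>A layer of height c over \<open>s\<close> equals c * \<open>card s\<close> times the
  coordinate vector of the barycentre of \<open>s\<close>; the factor \<open>card\<close> thus
  converts layer heights into barycentric coordinates.\<close>

definition sd_coord :: "'a \<Rightarrow> 'a \<Rightarrow> real" where
  "sd_coord x v = (if v \<in> barycentre ` K then
     real (card (inv_into K barycentre v)) * gap (\<Union>K) (\<beta> x) (inv_into K barycentre v) else 0)"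

lemma sd_coord_barycentre:
  "s \<in> K \<Longrightarrow> sd_coord x (barycentre s) = real (card s) * gap (\<Union>K) (\<beta> x) s"
  unfolding sd_coord_def by (simp add: inv_into_f_f[OF barycentre_inj])

lemma sd_vertices: "\<Union>sd_complex = barycentre ` K"
proof
  show "\<Union>sd_complex \<subseteq> barycentre ` K" unfolding sd_complex_def by auto
  show "barycentre ` K \<subseteq> \<Union>sd_complex"
  proof
    fix v assume "v \<in> barycentre ` K"
    then obtain s where s: "s \<in> K" "v = barycentre s" by auto
    have "{s} \<in> {C. C \<subseteq> K \<and> C \<noteq> {} \<and> chain_subset C}"
      using s by (simp add: chain_subset_def)
    then have "barycentre ` {s} \<in> sd_complex" unfolding sd_complex_def by (rule imageI)
    then show "v \<in> \<Union>sd_complex" using s by auto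
  qed
qed

lemma sum_sd_vertices: "(\<Sum>v\<in>\<Union>sd_complex. f v) = (\<Sum>s\<in>K. f (barycentre s))"
  unfolding sd_vertices by (simp add: sum.reindex[OF barycentre_inj])

lemma sd_abstract_complex: "abstract_complex sd_complex"
  unfolding abstract_complex_def
proof (intro conjI ballI allI impI)
  show "finite sd_complex" unfolding sd_complex_def using finite_complex by simp
next
  fix s assume "s \<in> sd_complex"
  then obtain C where C: "s = barycentre ` C" "C \<subseteq> K" "C \<noteq> {}"
    unfolding sd_complex_def by auto
  show "finite s" unfolding C(1) using finite_subset[OF C(2) finite_complex] by simp
  show "s \<noteq> {}" using C by simp
next
  fix s t assume "s \<in> sd_complex" and t: "t \<subseteq> s \<and> t \<noteq> {}"
  then obtain C where C: "s = barycentre ` C" "C \<subseteq> K" "chain_subset C"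
    unfolding sd_complex_def by auto
  then obtain D where D: "D \<subseteq> C" "t = barycentre ` D"
    using t by (auto simp: subset_image_iff)
  have "chain_subset D"
    using C(3) D(1) unfolding chain_subset_def by (meson subsetD)
  moreover have "D \<subseteq> K" "D \<noteq> {}" using D t C(2) by auto
  ultimately show "t \<in> sd_complex" unfolding sd_complex_def using D by simp
qed

text \<open>The support of the new coordinates consists of the barycentres of the layers of
  \<open>x\<close>, and these form a chain of faces.\<close>

lemma sd_coord_realization:
  assumes x: "x \<in> M"
  shows "sd_coord x \<in> realization sd_complex"
proof (rule coord_layers[OF x])
  fix C c
  assume C: "C \<noteq> {}" "C \<subseteq> K" "chain_subset C" "\<And>t. t \<in> C \<Longrightarrow> 0 < c t"
    and w: "\<And>v. \<beta> x v = (\<Sum>t | t \<in> C \<and> v \<in> t. c t)"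
  have g: "gap (\<Union>K) (\<beta> x) s = (if s \<in> C then c s else 0)" if "s \<in> K" for s
    by (rule gap_layers[OF C(2,3) _ w that]) (rule C(4))
  have eq: "sd_coord x (barycentre s) = (if s \<in> C then real (card s) * c s else 0)" if "s \<in> K" for s
    using that g[OF that] by (simp add: sd_coord_barycentre)
  have nz: "sd_coord x (barycentre s) \<noteq> 0 \<longleftrightarrow> s \<in> C" if "s \<in> K" for s
    using eq[OF that] card_simplex_pos[OF that] C(4)[of s] by auto
  have "{v. sd_coord x v \<noteq> 0} = barycentre ` C"
  proof (intro equalityI subsetI)
    fix v assume v: "v \<in> {v. sd_coord x v \<noteq> 0}"
    then have "v \<in> barycentre ` K" unfolding sd_coord_def by (auto split: if_splits)
    then show "v \<in> barycentre ` C" using v nz by auto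
  next
    fix v assume "v \<in> barycentre ` C"
    then show "v \<in> {v. sd_coord x v \<noteq> 0}" using nz C(2) by auto
  qed
  moreover have "barycentre ` C \<in> sd_complex" unfolding sd_complex_def using C by simp
  moreover have "0 \<le> sd_coord x v" for v unfolding sd_coord_def gap_def by simp
  moreover have "(\<Sum>v\<in>\<Union>sd_complex. sd_coord x v) = 1"
  proof -
    have "(\<Sum>v\<in>\<Union>sd_complex. sd_coord x v) = (\<Sum>s\<in>K. gap (\<Union>K) (\<beta> x) s * (\<Sum>v\<in>s. 1))"
      unfolding sum_sd_vertices by (rule sum.cong) (simp_all add: sd_coord_barycentre)
    also have "\<dots> = (\<Sum>v\<in>\<Union>K. \<beta> x v * 1)" by (rule sum_gap[OF x])
    finally show ?thesis using coord_sum[OF x] by simp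
  qed
  ultimately show ?thesis unfolding realization_def by simp
qed

text \<open>The old coordinates depend linearly on the new ones. This provides the inverse of the
  new coordinate map, and hence its injectivity.\<close>

lemma coord_eq_sum_sd_coord:
  assumes x: "x \<in> M"
  shows "\<beta> x u = (\<Sum>s\<in>K. sd_coord x (barycentre s) * uniform_weight s u)"
proof -
  have "(\<Sum>s\<in>K. sd_coord x (barycentre s) * uniform_weight s u)
      = (\<Sum>s\<in>K. gap (\<Union>K) (\<beta> x) s * (\<Sum>v\<in>s. if v = u then 1 else 0))"
    by (rule sum.cong)
      (use card_simplex_pos finite_simplex in \<open>auto simp: sd_coord_barycentre uniform_weight_def\<close>)
  also have "\<dots> = (\<Sum>v\<in>\<Union>K. \<beta> x v * (if v = u then 1 else 0))"
    by (rule sum_gap[OF x])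
  also have "\<dots> = \<beta> x u"
    using finite_vertices coord_outside[OF x, of u] by (simp add: if_distrib cong: if_cong)
  finally show ?thesis by (rule sym)
qed

text \<open>Weights on a chain, divided by the cardinalities, are read as layer heights. Their sum
  is a coordinate vector supported on the top member of the chain, hence comes from a point of
  \<open>M\<close>, and \<open>gap\<close> returns the heights one started with.\<close>

lemma sd_coord_surj:
  assumes w': "w' \<in> realization sd_complex"
  shows "w' \<in> sd_coord ` M"
proof -
  have "(\<forall>v. 0 \<le> w' v) \<and> {v. w' v \<noteq> 0} \<in> sd_complex \<and> (\<Sum>v\<in>\<Union>sd_complex. w' v) = 1"
    using w' unfolding realization_def mem_Collect_eq .
  then have supp: "{v. w' v \<noteq> 0} \<in> sd_complex" and nonneg: "\<And>v. 0 \<le> w' v"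
    and sum1: "(\<Sum>v\<in>\<Union>sd_complex. w' v) = 1"
    by simp_all
  obtain C where C: "{v. w' v \<noteq> 0} = barycentre ` C" "C \<subseteq> K" "C \<noteq> {}" "chain_subset C"
    using supp unfolding sd_complex_def by (elim imageE CollectE conjE)
  have finC: "finite C" using C(2) finite_complex by (rule finite_subset)
  have supp_iff: "w' (barycentre s) \<noteq> 0 \<longleftrightarrow> s \<in> C" if "s \<in> K" for s
  proof -
    have "w' (barycentre s) \<noteq> 0 \<longleftrightarrow> barycentre s \<in> barycentre ` C" using C(1) by auto
    also have "\<dots> \<longleftrightarrow> s \<in> C" by (rule inj_on_image_mem_iff[OF barycentre_inj that C(2)])
    finally show ?thesis .
  qed
  define c where "c s = w' (barycentre s) / real (card s)" for s
  have cpos: "0 < c t" if "t \<in> C" for t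
  proof -
    have "t \<in> K" using that C(2) by auto
    then have "0 \<noteq> w' (barycentre t)" using supp_iff[of t] that by simp
    with nonneg have "0 < w' (barycentre t)" by (rule le_neq_trans)
    then show ?thesis unfolding c_def using card_simplex_pos[OF \<open>t \<in> K\<close>] by simp
  qed
  define w where "w v = (\<Sum>t | t \<in> C \<and> v \<in> t. c t)" for v
  have "{v. w v \<noteq> 0} = \<Union>C"
  proof (intro equalityI subsetI)
    fix v assume "v \<in> {v. w v \<noteq> 0}"
    then have "(\<Sum>t | t \<in> C \<and> v \<in> t. c t) \<noteq> 0" unfolding w_def by simp
    then have "{t. t \<in> C \<and> v \<in> t} \<noteq> {}" by (intro notI) (simp only: sum.empty simp_thms)
    then show "v \<in> \<Union>C" by auto
  next
    fix v assume "v \<in> \<Union>C"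
    then have "{t. t \<in> C \<and> v \<in> t} \<noteq> {}" by auto
    then have "0 < w v" unfolding w_def using cpos finC by (intro sum_pos) auto
    then show "v \<in> {v. w v \<noteq> 0}" by simp
  qed
  moreover have "\<Union>C \<in> K" using finite_chain_Union_mem[OF finC C(3,4)] C(2) by auto
  moreover have "0 \<le> w v" for v
    unfolding w_def using cpos by (intro sum_nonneg) (auto intro: less_imp_le)
  moreover have "(\<Sum>v\<in>\<Union>K. w v) = 1"
  proof -
    have "(\<Sum>v\<in>\<Union>K. w v) = (\<Sum>v\<in>\<Union>K. (\<Sum>t | t \<in> C \<and> v \<in> t. c t) * 1)" by (simp add: w_def)
    also have "\<dots> = (\<Sum>t\<in>C. c t * (\<Sum>v\<in>t. 1))"
      by (rule sum_chain_layers[OF finite_vertices finC]) (use C(2) in auto)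
    also have "\<dots> = (\<Sum>t\<in>C. w' (barycentre t))"
    proof (rule sum.cong)
      fix t assume "t \<in> C"
      then have "0 < card t" using C(2) card_simplex_pos by auto
      then show "c t * (\<Sum>v\<in>t. 1) = w' (barycentre t)" by (simp add: c_def)
    qed simp
    also have "\<dots> = (\<Sum>t\<in>K. w' (barycentre t))"
    proof (rule sum.mono_neutral_left[OF finite_complex C(2)])
      show "\<forall>t\<in>K - C. w' (barycentre t) = 0"
      proof
        fix t assume "t \<in> K - C"
        then show "w' (barycentre t) = 0" using supp_iff[of t] by simp
      qed
    qed
    also have "\<dots> = 1" using sum1 unfolding sum_sd_vertices .
    finally show ?thesis .
  qed
  ultimately have "w \<in> realization K" unfolding realization_def mem_Collect_eq by simp
  then obtain x where x: "x \<in> M" "\<beta> x = w"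
    unfolding coord_image[symmetric] by (elim imageE) simp
  have "sd_coord x v = w' v" for v
  proof (cases "v \<in> barycentre ` K")
    case True
    then obtain s where s: "s \<in> K" "v = barycentre s" by auto
    have "gap (\<Union>K) (\<beta> x) s = (if s \<in> C then c s else 0)"
      by (rule gap_layers[OF C(2,4) cpos _ s(1)]) (simp_all add: x w_def)
    then show ?thesis
      using s supp_iff[OF s(1)] card_simplex_pos[OF s(1)]
      by (auto simp: sd_coord_barycentre c_def)
  next
    case False
    then have "v \<notin> barycentre ` C" using C(2) by auto
    then have "w' v = 0" using C(1) by auto
    then show ?thesis using False by (simp add: sd_coord_def)
  qed
  then have "w' = sd_coord x" by (intro ext) simp
  then show ?thesis using x by simp
qed

lemma sd_coord_pl:
  assumes "v \<in> \<Union>sd_complex"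
  shows "pl_on M (\<lambda>x. sd_coord x v)"
proof -
  obtain s where s: "s \<in> K" "v = barycentre s" using assms sd_vertices by auto
  obtain v0 where v0: "v0 \<in> s" using simplex_nonempty[OF s(1)] by auto
  have pl: "pl_on M (\<lambda>x. \<beta> x u)" if "u \<in> s \<or> u \<in> \<Union>K - s" for u
    by (rule coord_pl) (use that s(1) in auto)
  have mn: "pl_on M (\<lambda>x. Min ((\<lambda>u. \<beta> x u) ` s))"
    by (rule pl_on_Min) (use s finite_simplex simplex_nonempty pl in auto)
  have const: "pl_on M (\<lambda>x. 0::real)" using pl_on_const[OF mn] .
  \<comment> \<open>The case \<open>s = \<Union>K\<close> is split off because \<open>Max\<close> of
    the empty set has no usable value.\<close>
  have mx: "pl_on M (\<lambda>x. Max (insert 0 ((\<lambda>u. \<beta> x u) ` (\<Union>K - s))))"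
  proof (cases "\<Union>K - s = {}")
    case True
    show ?thesis unfolding True using const by simp
  next
    case False
    have "pl_on M (\<lambda>x. max 0 (Max ((\<lambda>u. \<beta> x u) ` (\<Union>K - s))))"
      by (rule pl_on_max[OF const pl_on_Max]) (use False finite_vertices pl in auto)
    moreover have "Max (insert 0 ((\<lambda>u. \<beta> x u) ` (\<Union>K - s))) = max 0 (Max ((\<lambda>u. \<beta> x u) ` (\<Union>K - s)))" for x
      by (rule Max_insert) (use False finite_vertices in auto)
    ultimately show ?thesis by (simp only:)
  qed
  show ?thesis
    unfolding s(2) sd_coord_barycentre[OF s(1)] gap_def
    by (rule pl_on_cmult[OF pl_on_max[OF const pl_on_diff[OF mn mx]]])
qed

lemma sd_coord_vertex:
  assumes "v \<in> \<Union>sd_complex"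
  shows "sd_coord v = (\<lambda>u. if u = v then 1 else 0)"
proof
  fix u
  obtain s where s: "s \<in> K" "v = barycentre s" using assms sd_vertices by auto
  \<comment> \<open>A barycentre has a single layer, namely its own face.\<close>
  have layers: "\<beta> v a = (\<Sum>t | t \<in> {s} \<and> a \<in> t. 1 / real (card t))" for a
    using coord_barycentre[OF s(1)] by (simp add: s(2) uniform_weight_def Collect_conv_if cong: conj_cong)
  show "sd_coord v u = (if u = v then 1 else 0)"
  proof (cases "u \<in> barycentre ` K")
    case True
    then obtain t where t: "t \<in> K" "u = barycentre t" by auto
    have "gap (\<Union>K) (\<beta> v) t = (if t \<in> {s} then 1 / real (card t) else 0)"
      by (rule gap_layers[OF _ _ _ layers t(1)])
        (use s card_simplex_pos in \<open>auto simp: chain_subset_def\<close>)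
    moreover have "u = v \<longleftrightarrow> t = s"
      unfolding s(2) t(2) by (rule inj_on_eq_iff[OF barycentre_inj t(1) s(1)])
    moreover have "sd_coord v u = real (card t) * gap (\<Union>K) (\<beta> v) t"
      unfolding t(2) by (rule sd_coord_barycentre[OF t(1)])
    ultimately show ?thesis
      using card_simplex_pos[OF t(1)] by auto
  next
    case False
    moreover from this have "u \<noteq> v" using s by auto
    ultimately show ?thesis by (simp add: sd_coord_def)
  qed
qed

theorem sd_triangulation: "pl_triangulation M sd_complex sd_coord"
  unfolding pl_triangulation_def
proof (intro conjI ballI)
  show "abstract_complex sd_complex" by (rule sd_abstract_complex)
  show "\<Union>sd_complex \<subseteq> M" using sd_vertices barycentre_in by auto
  show "sd_coord v = (\<lambda>u. if u = v then 1 else 0)" if "v \<in> \<Union>sd_complex" for v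
    using that by (rule sd_coord_vertex)
  show "pl_on M (\<lambda>x. sd_coord x v)" if "v \<in> \<Union>sd_complex" for v
    using that by (rule sd_coord_pl)
  have "continuous_on M (\<lambda>x. sd_coord x v)" for v
  proof (cases "v \<in> \<Union>sd_complex")
    case True
    then show ?thesis by (rule pl_on_imp_continuous_on[OF sd_coord_pl])
  next
    case False
    then show ?thesis by (simp add: sd_vertices sd_coord_def)
  qed
  then have cont: "continuous_on M sd_coord" by (rule continuous_on_coordinatewise_then_product)
  have img: "sd_coord ` M = realization sd_complex"
    using sd_coord_realization sd_coord_surj by auto
  obtain h where h: "homeomorphism M (realization K) \<beta> h"
    using coord_homeomorphism by (elim exE)
  \<comment> \<open>The linear map from new to old coordinates. It is a finite sum and so continuous
    on the realization; following it by the old inverse \<open>h\<close> gives a continuous inverse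
    of \<open>sd_coord\<close>.\<close>
  define W where "W w u = (\<Sum>s\<in>K. w (barycentre s) * uniform_weight s u)" for w :: "'a \<Rightarrow> real" and u
  have W: "W (sd_coord x) = \<beta> x" if "x \<in> M" for x
    unfolding W_def by (intro ext) (rule coord_eq_sum_sd_coord[OF that, symmetric])
  have hW: "h (W (sd_coord x)) = x" if "x \<in> M" for x
    unfolding W[OF that] by (rule homeomorphism_apply1[OF h that])
  have W_cont: "continuous_on (realization sd_complex) W"
  proof (rule continuous_on_coordinatewise_then_product)
    show "continuous_on (realization sd_complex) (\<lambda>w. W w u)" for u
      unfolding W_def
      by (intro continuous_on_sum continuous_on_mult_right
          continuous_on_product_then_coordinatewise[OF continuous_on_id])
  qed
  have W_image: "W ` realization sd_complex = realization K"
    unfolding img[symmetric] coord_image[symmetric] image_image by (rule image_cong[OF refl W])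
  have "homeomorphism M (realization sd_complex) sd_coord (\<lambda>w. h (W w))"
  proof (rule homeomorphismI)
    show "continuous_on (realization sd_complex) (\<lambda>w. h (W w))"
      by (rule continuous_on_compose2[OF homeomorphism_cont2[OF h] W_cont]) (simp add: W_image)
    show "sd_coord ` M \<subseteq> realization sd_complex" using img by simp
    show "(\<lambda>w. h (W w)) ` realization sd_complex \<subseteq> M"
      unfolding img[symmetric] image_image using hW by (simp add: image_subset_iff)
    fix w assume "w \<in> realization sd_complex"
    then obtain x where "x \<in> M" "w = sd_coord x" unfolding img[symmetric] by (elim imageE)
    then show "sd_coord (h (W w)) = w" using hW[of x] by simp
  qed (use cont hW in simp_all)
  then show "\<exists>h. homeomorphism M (realization sd_complex) sd_coord h"
    by (intro exI[of _ "\<lambda>w. h (W w)"])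
qed

section \<open>Shrinking of simplices under subdivision\<close>

lemma barycentre_mean:
  assumes \<phi>: "simplexwise_affine M K \<beta> \<phi>" and s: "s \<in> K"
  shows "\<phi> (barycentre s) = (\<Sum>v\<in>s. \<phi> v) / real (card s)"
proof -
  have "\<Union>K \<inter> s = s" using s by auto
  have "\<phi> (barycentre s) = (\<Sum>v\<in>\<Union>K. \<beta> (barycentre s) v * \<phi> v)"
    using \<phi> barycentre_in[OF s] unfolding simplexwise_affine_def by (rule bspec)
  also have "\<dots> = (\<Sum>v\<in>\<Union>K. if v \<in> s then \<phi> v / real (card s) else 0)"
    unfolding coord_barycentre[OF s] by (rule sum.cong) (simp_all add: uniform_weight_def)
  also have "\<dots> = (\<Sum>v\<in>\<Union>K \<inter> s. \<phi> v / real (card s))"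
    by (rule sum.inter_restrict[OF finite_vertices, symmetric])
  finally show ?thesis unfolding \<open>\<Union>K \<inter> s = s\<close> sum_divide_distrib .
qed

lemma sd_affine:
  assumes \<phi>: "simplexwise_affine M K \<beta> \<phi>"
  shows "simplexwise_affine M sd_complex sd_coord \<phi>"
  unfolding simplexwise_affine_def
proof
  fix x assume x: "x \<in> M"
  have "\<phi> x = (\<Sum>v\<in>\<Union>K. \<beta> x v * \<phi> v)"
    using \<phi> x unfolding simplexwise_affine_def by (rule bspec)
  also have "\<dots> = (\<Sum>s\<in>K. gap (\<Union>K) (\<beta> x) s * (\<Sum>v\<in>s. \<phi> v))"
    by (rule sum_gap[OF x, symmetric])
  also have "\<dots> = (\<Sum>s\<in>K. sd_coord x (barycentre s) * \<phi> (barycentre s))"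
  proof (rule sum.cong)
    fix s assume s: "s \<in> K"
    show "gap (\<Union>K) (\<beta> x) s * (\<Sum>v\<in>s. \<phi> v) = sd_coord x (barycentre s) * \<phi> (barycentre s)"
      using card_simplex_pos[OF s] unfolding sd_coord_barycentre[OF s] barycentre_mean[OF \<phi> s] by simp
  qed simp
  finally show "\<phi> x = (\<Sum>v\<in>\<Union>sd_complex. sd_coord x v * \<phi> v)"
    unfolding sum_sd_vertices .
qed

text \<open>Members of a chain of faces have distinct cardinalities between 1 and \<open>N\<close>.
  The contraction factor therefore stays the same through all subdivisions.\<close>

lemma sd_card:
  assumes N: "\<And>s. s \<in> K \<Longrightarrow> card s \<le> N" and S: "S \<in> sd_complex"
  shows "card S \<le> N"
proof -
  obtain C where C: "S = barycentre ` C" "C \<subseteq> K" "chain_subset C"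
    using S unfolding sd_complex_def by (elim imageE CollectE conjE)
  have finC: "finite C" using C(2) finite_complex by (rule finite_subset)
  have "inj_on card C"
  proof (rule inj_onI)
    fix s t assume st: "s \<in> C" "t \<in> C" "card s = card t"
    have "finite s" "finite t" using st C(2) finite_simplex by auto
    moreover have "s \<subseteq> t \<or> t \<subseteq> s" using C(3) st unfolding chain_subset_def by simp
    ultimately show "s = t" using st(3) card_subset_eq by metis
  qed
  then have "card C = card (card ` C)" by (rule card_image[symmetric])
  also have "\<dots> \<le> card {1..N}"
  proof (rule card_mono)
    show "card ` C \<subseteq> {1..N}"
    proof
      fix k assume "k \<in> card ` C"
      then obtain s where "s \<in> K" "k = card s" using C(2) by auto
      then show "k \<in> {1..N}" using N[of s] card_simplex_pos[of s] by simp
    qed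
  qed simp
  finally show ?thesis using card_image_le[OF finC, of barycentre] C(1) by simp
qed

text \<open>Two vertices of a new simplex are barycentres of nested faces, and the value of an
  affine function at a barycentre is the mean over the face, so the estimate for means of nested
  sets applies.\<close>

lemma sd_oscillation:
  assumes \<phi>: "simplexwise_affine M K \<beta> \<phi>" and osc: "oscillation_le K \<phi> \<epsilon>"
    and N: "\<And>s. s \<in> K \<Longrightarrow> card s \<le> N"
  shows "oscillation_le sd_complex \<phi> ((1 - 1 / real N) * \<epsilon>)"
proof -
  have le: "\<bar>\<phi> (barycentre s) - \<phi> (barycentre t)\<bar> \<le> (1 - 1 / real N) * \<epsilon>"
    if st: "s \<in> K" "t \<in> K" "s \<subseteq> t" for s t
  proof -
    have t: "\<bar>\<phi> u - \<phi> v\<bar> \<le> \<epsilon>" if "u \<in> t" "v \<in> t" for u v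
      using osc st(2) that unfolding oscillation_le_def by simp
    obtain u where "u \<in> t" using simplex_nonempty[OF st(2)] by auto
    \<comment> \<open>Comparing a vertex with itself shows that the bound is nonnegative, as needed
      for weakening the factor to 1 - 1/\<open>N\<close>.\<close>
    then have "0 \<le> \<epsilon>" using t[of u u] by simp
    have "\<bar>\<phi> (barycentre s) - \<phi> (barycentre t)\<bar> \<le> (1 - 1 / real (card t)) * \<epsilon>"
      unfolding barycentre_mean[OF \<phi> st(1)] barycentre_mean[OF \<phi> st(2)]
      by (rule mean_diff_le[OF finite_simplex[OF st(2)] st(3) simplex_nonempty[OF st(1)] t])
    also have "\<dots> \<le> (1 - 1 / real N) * \<epsilon>"
    proof (rule mult_right_mono[OF _ \<open>0 \<le> \<epsilon>\<close>])
      have "1 / real N \<le> 1 / real (card t)"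
        using N[OF st(2)] card_simplex_pos[OF st(2)] by (intro divide_left_mono) simp_all
      then show "1 - 1 / real (card t) \<le> 1 - 1 / real N" by simp
    qed
    finally show ?thesis .
  qed
  show ?thesis
    unfolding oscillation_le_def
  proof (intro ballI)
    fix S u v assume S: "S \<in> sd_complex" and uv: "u \<in> S" "v \<in> S"
    obtain C where C: "S = barycentre ` C" "C \<subseteq> K" "chain_subset C"
      using S unfolding sd_complex_def by (elim imageE CollectE conjE)
    obtain s t where st: "s \<in> C" "u = barycentre s" "t \<in> C" "v = barycentre t"
      using uv unfolding C(1) by (elim imageE)
    have K: "s \<in> K" "t \<in> K" using st C(2) by auto
    have "s \<subseteq> t \<or> t \<subseteq> s" using C(3) st(1,3) unfolding chain_subset_def by simp
    then show "\<bar>\<phi> u - \<phi> v\<bar> \<le> (1 - 1 / real N) * \<epsilon>"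
      using le[OF K] le[OF K(2,1)] unfolding st(2,4) by (elim disjE) (simp_all add: abs_minus_commute)
  qed
qed

section \<open>Compatibility with the involution\<close>

lemma
  assumes A: "free_involution M A" and equiv: "equivariant M A K \<beta>"
  shows equivariant_coord: "\<And>x v. x \<in> M \<Longrightarrow> v \<in> \<Union>K \<Longrightarrow> \<beta> (A x) (A v) = \<beta> x v"
    and bij_betw_vertices: "bij_betw A (\<Union>K) (\<Union>K)"
proof -
  have AK: "A ` s \<in> K" if "s \<in> K" for s
    using equiv that unfolding equivariant_def by simp
  have AV: "A v \<in> \<Union>K" if "v \<in> \<Union>K" for v
    using that AK by auto
  have AA: "A (A v) = v" if "v \<in> \<Union>K" for v
    using that vertices_subset A unfolding free_involution_def by auto
  show "\<beta> (A x) (A v) = \<beta> x v" if "x \<in> M" "v \<in> \<Union>K" for x v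
  proof -
    have "\<forall>x\<in>M. \<forall>v\<in>\<Union>K. \<beta> (A x) (A v) = \<beta> x v"
      using equiv unfolding equivariant_def by (elim conjE)
    from bspec[OF bspec[OF this that(1)] that(2)] show ?thesis .
  qed
  show "bij_betw A (\<Union>K) (\<Union>K)"
  proof (rule bij_betw_byWitness[where f' = A])
    show "\<forall>v\<in>\<Union>K. A (A v) = v" by (intro ballI AA)
    then show "\<forall>v\<in>\<Union>K. A (A v) = v" .
    show "A ` \<Union>K \<subseteq> \<Union>K" by (intro image_subsetI AV)
    then show "A ` \<Union>K \<subseteq> \<Union>K" .
  qed
qed

lemma sd_equivariant:
  assumes A: "free_involution M A" and equiv: "equivariant M A K \<beta>"
  shows "equivariant M A sd_complex sd_coord"
proof -
  note coord = equivariant_coord[OF A equiv]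
  have AM: "A x \<in> M" and AA: "A (A x) = x" if "x \<in> M" for x
    using A that unfolding free_involution_def by auto
  have AK: "A ` s \<in> K" if "s \<in> K" for s
    using equiv that unfolding equivariant_def by simp
  have AV: "A v \<in> \<Union>K" if "v \<in> \<Union>K" for v
    using that AK by auto
  have AAv: "A (A v) = v" if "v \<in> \<Union>K" for v
    using that vertices_subset AA by auto
  have image_AV: "A ` \<Union>K = \<Union>K" and inj: "inj_on A (\<Union>K)"
    using bij_betw_vertices[OF A equiv] by (simp_all add: bij_betw_def)
  \<comment> \<open>An identity between points of \<open>M\<close>, checked on coordinates because
    these are injective.\<close>
  have A_bary: "A (barycentre s) = barycentre (A ` s)" if s: "s \<in> K" for s
  proof (rule inj_onD[OF coord_inj])
    have sV: "s \<subseteq> \<Union>K" "A ` s \<subseteq> \<Union>K" using s AK[OF s] by auto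
    have card: "card (A ` s) = card s" by (rule card_image[OF inj_on_subset[OF inj sV(1)]])
    show "\<beta> (A (barycentre s)) = \<beta> (barycentre (A ` s))"
      unfolding coord_barycentre[OF AK[OF s]]
    proof
      fix u
      show "\<beta> (A (barycentre s)) u = uniform_weight (A ` s) u"
      proof (cases "u \<in> \<Union>K")
        case True
        \<comment> \<open>Equivariance speaks of coordinates at vertices of the form
          \<open>A v\<close>, so \<open>u\<close> is written as \<open>A (A u)\<close>.\<close>
        have "\<beta> (A (barycentre s)) u = \<beta> (A (barycentre s)) (A (A u))" using AAv[OF True] by simp
        also have "\<dots> = uniform_weight s (A u)"
          unfolding coord[OF barycentre_in[OF s] AV[OF True]] coord_barycentre[OF s] ..
        also have "\<dots> = uniform_weight (A ` s) u"
        proof -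
          have "A u \<in> s \<longleftrightarrow> A (A u) \<in> A ` s"
            by (rule inj_on_image_mem_iff[OF inj AV[OF True] sV(1), symmetric])
          then show ?thesis unfolding uniform_weight_def card AAv[OF True] by simp
        qed
        finally show ?thesis .
      next
        case False
        then have "u \<notin> A ` s" using sV(2) by auto
        then show ?thesis
          using coord_outside[OF AM[OF barycentre_in[OF s]] False] by (simp add: uniform_weight_def)
      qed
    qed
  qed (simp_all add: AM barycentre_in AK s)
  show ?thesis
    unfolding equivariant_def
  proof (intro conjI ballI)
    fix S assume "S \<in> sd_complex"
    then obtain C where C: "S = barycentre ` C" "C \<subseteq> K" "C \<noteq> {}" "chain_subset C"
      unfolding sd_complex_def by (elim imageE CollectE conjE)
    have "A ` S = barycentre ` (image A ` C)"
      unfolding C(1) image_image by (rule image_cong) (use A_bary C(2) in auto)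
    moreover have "image A ` C \<subseteq> K" using C(2) AK by auto
    moreover have "chain_subset (image A ` C)"
      using C(4) unfolding chain_subset_def by (simp add: image_mono) (meson image_mono)
    ultimately show "A ` S \<in> sd_complex" unfolding sd_complex_def using C(3) by simp
  next
    fix x v assume x: "x \<in> M" and "v \<in> \<Union>sd_complex"
    then obtain s where s: "s \<in> K" "v = barycentre s" unfolding sd_vertices by (elim imageE)
    have sV: "s \<subseteq> \<Union>K" using s by auto
    \<comment> \<open>The gap of a face depends only on the sets of coordinate values on and off the
      face, and \<open>A\<close> preserves both sets.\<close>
    have "\<beta> (A x) ` (A ` s) = \<beta> x ` s"
      unfolding image_image by (rule image_cong[OF refl]) (rule coord[OF x subsetD[OF sV]])
    moreover have "\<beta> (A x) ` (\<Union>K - A ` s) = \<beta> x ` (\<Union>K - s)"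
    proof -
      have "\<Union>K - A ` s = A ` (\<Union>K - s)"
        using inj_on_image_set_diff[OF inj _ sV, of "\<Union>K"] image_AV by simp
      then show ?thesis
        by (simp only: image_image) (rule image_cong[OF refl], rule coord[OF x DiffD1])
    qed
    moreover have "card (A ` s) = card s" by (rule card_image[OF inj_on_subset[OF inj sV]])
    ultimately show "sd_coord (A x) (A v) = sd_coord x v"
      unfolding s(2) A_bary[OF s(1)] sd_coord_barycentre[OF s(1)] sd_coord_barycentre[OF AK[OF s(1)]]
        gap_def by simp
  qed
qed

end

text \<open>The subdivision is chosen before \<open>\<phi>\<close>, so one triangulation serves all
  coordinate functions of \<open>K\<close> simultaneously.\<close>

lemma iterated_subdivision:
  assumes A: "free_involution M A"
    and K: "pl_triangulation M K \<beta>" "equivariant M A K \<beta>" "\<forall>s\<in>K. card s \<le> N"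
  shows "\<exists>K' \<beta>'. pl_triangulation M K' \<beta>' \<and> equivariant M A K' \<beta>' \<and> (\<forall>s\<in>K'. card s \<le> N) \<and>
    (\<forall>\<phi> \<epsilon>. simplexwise_affine M K \<beta> \<phi> \<and> oscillation_le K \<phi> \<epsilon> \<longrightarrow>
      simplexwise_affine M K' \<beta>' \<phi> \<and> oscillation_le K' \<phi> ((1 - 1 / real N) ^ m * \<epsilon>))"
proof (induction m)
  case 0
  show ?case by (rule exI[of _ K], rule exI[of _ \<beta>]) (use K in simp)
next
  case (Suc m)
  then obtain K' \<beta>' where K': "pl_triangulation M K' \<beta>'" "equivariant M A K' \<beta>'" "\<forall>s\<in>K'. card s \<le> N"
    and fine: "\<forall>\<phi> \<epsilon>. simplexwise_affine M K \<beta> \<phi> \<and> oscillation_le K \<phi> \<epsilon> \<longrightarrow>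
      simplexwise_affine M K' \<beta>' \<phi> \<and> oscillation_le K' \<phi> ((1 - 1 / real N) ^ m * \<epsilon>)"
    by (elim exE conjE)
  interpret triangulated M K' \<beta>' by standard (rule K'(1))
  have card: "card s \<le> N" if "s \<in> K'" for s using K'(3) that by (rule bspec)
  have step: "simplexwise_affine M sd_complex sd_coord \<phi> \<and>
      oscillation_le sd_complex \<phi> ((1 - 1 / real N) ^ Suc m * \<epsilon>)"
    if "simplexwise_affine M K \<beta> \<phi> \<and> oscillation_le K \<phi> \<epsilon>" for \<phi> \<epsilon>
  proof -
    have "simplexwise_affine M K' \<beta>' \<phi>" "oscillation_le K' \<phi> ((1 - 1 / real N) ^ m * \<epsilon>)"
      using mp[OF spec[OF spec[OF fine]] that] by simp_all
    from sd_affine[OF this(1)] sd_oscillation[OF this card] show ?thesis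
      by (simp add: mult.assoc)
  qed
  show ?case
  proof (rule exI[of _ sd_complex], rule exI[of _ sd_coord], intro conjI)
    show "pl_triangulation M sd_complex sd_coord" by (rule sd_triangulation)
    show "equivariant M A sd_complex sd_coord" by (rule sd_equivariant[OF A K'(2)])
    show "\<forall>s\<in>sd_complex. card s \<le> N" by (intro ballI sd_card[OF card])
    show "\<forall>\<phi> \<epsilon>. simplexwise_affine M K \<beta> \<phi> \<and> oscillation_le K \<phi> \<epsilon> \<longrightarrow>
      simplexwise_affine M sd_complex sd_coord \<phi> \<and>
      oscillation_le sd_complex \<phi> ((1 - 1 / real N) ^ Suc m * \<epsilon>)"
      by (intro allI impI step)
  qed
qed

section \<open>Uniform continuity in barycentric coordinates\<close>

context triangulated
begin

lemma affine_coord: "simplexwise_affine M K \<beta> (\<lambda>x. \<beta> x u)"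
  unfolding simplexwise_affine_def
proof
  fix x assume x: "x \<in> M"
  have "(\<Sum>v\<in>\<Union>K. \<beta> x v * \<beta> v u) = (\<Sum>v\<in>\<Union>K. if v = u then \<beta> x v else 0)"
    by (rule sum.cong) (auto simp: coord_vertex)
  also have "\<dots> = \<beta> x u"
    using finite_vertices coord_outside[OF x, of u] by simp
  finally show "\<beta> x u = (\<Sum>v\<in>\<Union>K. \<beta> x v * \<beta> v u)" by (rule sym)
qed

lemma oscillation_coord: "oscillation_le K (\<lambda>x. \<beta> x u) 1"
  unfolding oscillation_le_def
proof (intro ballI)
  fix s v w assume "s \<in> K" "v \<in> s" "w \<in> s"
  then have "v \<in> \<Union>K" "w \<in> \<Union>K" by auto
  then show "\<bar>\<beta> v u - \<beta> w u\<bar> \<le> 1" by (simp add: coord_vertex)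
qed

text \<open>Pairs of points on which the \<open>F i\<close> differ by at least \<delta> in total
  form a compact set. The coordinate distance \<open>d\<close> is positive there, since coordinates
  separate points, and so it has a positive minimum.\<close>

lemma coords_close_imp_close:
  fixes F :: "'i \<Rightarrow> 'a \<Rightarrow> real"
  assumes F: "\<And>i. i \<in> I \<Longrightarrow> continuous_on M (F i)" and \<delta>: "0 < \<delta>"
  obtains \<epsilon> where "0 < \<epsilon>" "\<And>x y. x \<in> M \<Longrightarrow> y \<in> M \<Longrightarrow> (\<And>u. \<bar>\<beta> x u - \<beta> y u\<bar> \<le> \<epsilon>) \<Longrightarrow>
    (\<Sum>i\<in>I. \<bar>F i x - F i y\<bar>) < \<delta>"
proof -
  define G where "G z = (\<Sum>i\<in>I. \<bar>F i (fst z) - F i (snd z)\<bar>)" for z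
  define d where "d z = (\<Sum>u\<in>\<Union>K. \<bar>\<beta> (fst z) u - \<beta> (snd z) u\<bar>)" for z
  have on_fst: "continuous_on (M \<times> M) (\<lambda>z. f (fst z))" if "continuous_on M f" for f :: "'a \<Rightarrow> real"
    by (rule continuous_on_compose2[OF that continuous_on_fst[OF continuous_on_id]]) auto
  have on_snd: "continuous_on (M \<times> M) (\<lambda>z. f (snd z))" if "continuous_on M f" for f :: "'a \<Rightarrow> real"
    by (rule continuous_on_compose2[OF that continuous_on_snd[OF continuous_on_id]]) auto
  have G_cont: "continuous_on (M \<times> M) G"
    unfolding G_def
    by (rule continuous_on_sum, rule continuous_on_rabs, rule continuous_on_diff)
      (rule on_fst[OF F] on_snd[OF F], assumption)+
  have d_cont: "continuous_on (M \<times> M) d"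
    unfolding d_def
    by (rule continuous_on_sum, rule continuous_on_rabs, rule continuous_on_diff)
      (rule on_fst[OF continuous_on_coord] on_snd[OF continuous_on_coord])+
  let ?bad = "{z \<in> M \<times> M. \<delta> \<le> G z}"
  have compact_bad: "compact ?bad"
  proof -
    have "closedin (top_of_set (M \<times> M)) ((M \<times> M) \<inter> G -` {\<delta>..})"
      by (rule continuous_closedin_preimage[OF G_cont closed_atLeast])
    moreover have "(M \<times> M) \<inter> G -` {\<delta>..} = ?bad" by auto
    ultimately show ?thesis
      using closedin_compact[OF compact_Times[OF compact_carrier compact_carrier]] by metis
  qed
  show ?thesis
  proof (cases "?bad = {}")
    case True
    show ?thesis
    proof (rule that[of 1])
      fix x y assume "x \<in> M" "y \<in> M"
      then have "\<not> \<delta> \<le> G (x, y)" using True by blast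
      then show "(\<Sum>i\<in>I. \<bar>F i x - F i y\<bar>) < \<delta>" by (simp add: G_def)
    qed simp
  next
    case False
    have "continuous_on ?bad d" by (rule continuous_on_subset[OF d_cont]) auto
    from continuous_attains_inf[OF compact_bad False this]
    obtain z where z: "z \<in> ?bad" "\<forall>y\<in>?bad. d z \<le> d y" by (elim bexE)
    have "0 < d z"
    proof (rule ccontr)
      assume "\<not> 0 < d z"
      moreover have "0 \<le> d z" unfolding d_def by (rule sum_nonneg) simp
      ultimately have "d z = 0" by simp
      then have "\<forall>u\<in>\<Union>K. \<bar>\<beta> (fst z) u - \<beta> (snd z) u\<bar> = 0"
        unfolding d_def by (subst (asm) sum_nonneg_eq_0_iff[OF finite_vertices]) simp_all
      then have "\<beta> (fst z) u = \<beta> (snd z) u" for u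
        using coord_outside[of "fst z" u] coord_outside[of "snd z" u] z(1) by (cases "u \<in> \<Union>K") auto
      then have "\<beta> (fst z) = \<beta> (snd z)" by (rule ext)
      then have "fst z = snd z"
        by (rule inj_onD[OF coord_inj]) (use z(1) in auto)
      then have "G z = 0" unfolding G_def by simp
      then show False using z(1) \<delta> by simp
    qed
    \<comment> \<open>If all coordinates differ by at most this bound, their total difference is
      strictly below \<open>d z\<close>. The added 1 gives strictness and keeps the denominator
      positive.\<close>
    show ?thesis
    proof (rule that[of "d z / (real (card (\<Union>K)) + 1)"])
      show "0 < d z / (real (card (\<Union>K)) + 1)" using \<open>0 < d z\<close> by (intro divide_pos_pos) simp_all
      fix x y assume xy: "x \<in> M" "y \<in> M"
        and close: "\<And>u. \<bar>\<beta> x u - \<beta> y u\<bar> \<le> d z / (real (card (\<Union>K)) + 1)"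
      show "(\<Sum>i\<in>I. \<bar>F i x - F i y\<bar>) < \<delta>"
      proof (rule ccontr)
        assume "\<not> (\<Sum>i\<in>I. \<bar>F i x - F i y\<bar>) < \<delta>"
        then have "(x, y) \<in> ?bad" using xy by (simp add: G_def)
        with z(2) have "d z \<le> d (x, y)" by (rule bspec)
        also have "\<dots> \<le> (\<Sum>u\<in>\<Union>K. d z / (real (card (\<Union>K)) + 1))"
          unfolding d_def fst_conv snd_conv by (rule sum_mono) (rule close[unfolded d_def])
        also have "\<dots> < d z" using \<open>0 < d z\<close> by (simp add: field_simps)
        finally show False by simp
      qed
    qed
  qed
qed

lemma fine_equivariant_triangulation:
  fixes F :: "'i \<Rightarrow> 'a \<Rightarrow> real"
  assumes A: "free_involution M A" and equiv: "equivariant M A K \<beta>"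
    and F: "\<And>i. i \<in> I \<Longrightarrow> continuous_on M (F i)" and \<delta>: "0 < \<delta>"
  obtains K' \<beta>' where "pl_triangulation M K' \<beta>'" "equivariant M A K' \<beta>'"
    "\<forall>s\<in>K'. \<forall>u\<in>s. \<forall>v\<in>s. (\<Sum>i\<in>I. \<bar>F i u - F i v\<bar>) < \<delta>"
proof -
  obtain \<epsilon> where \<epsilon>: "0 < \<epsilon>" and close: "\<And>x y. x \<in> M \<Longrightarrow> y \<in> M \<Longrightarrow> (\<And>u. \<bar>\<beta> x u - \<beta> y u\<bar> \<le> \<epsilon>) \<Longrightarrow>
    (\<Sum>i\<in>I. \<bar>F i x - F i y\<bar>) < \<delta>"
    using coords_close_imp_close[of I F, OF F \<delta>] by metis
  \<comment> \<open>The successor makes \<open>N\<close> positive, so that 1 - 1/\<open>N\<close> is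
    below 1; with \<open>N = 0\<close> the quotient would be 0.\<close>
  define N where "N = Suc (card (\<Union>K))"
  have N: "\<forall>s\<in>K. card s \<le> N"
  proof
    fix s assume "s \<in> K"
    then have "card s \<le> card (\<Union>K)" by (intro card_mono[OF finite_vertices]) auto
    then show "card s \<le> N" by (simp add: N_def)
  qed
  have "1 - 1 / real N < 1" by (simp add: N_def)
  then obtain m where m: "(1 - 1 / real N) ^ m < \<epsilon>" using real_arch_pow_inv[OF \<epsilon>] by metis
  from iterated_subdivision[OF A triangulation equiv N, of m]
  obtain K' \<beta>' where K': "pl_triangulation M K' \<beta>'" "equivariant M A K' \<beta>'"
    and fine: "\<forall>\<phi> \<epsilon>. simplexwise_affine M K \<beta> \<phi> \<and> oscillation_le K \<phi> \<epsilon> \<longrightarrow>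
      simplexwise_affine M K' \<beta>' \<phi> \<and> oscillation_le K' \<phi> ((1 - 1 / real N) ^ m * \<epsilon>)"
    by (elim exE conjE)
  interpret K': triangulated M K' \<beta>' by standard (rule K'(1))
  show ?thesis
  proof (rule that[OF K'], intro ballI)
    fix s u v assume s: "s \<in> K'" "u \<in> s" "v \<in> s"
    show "(\<Sum>i\<in>I. \<bar>F i u - F i v\<bar>) < \<delta>"
    proof (rule close)
      show "u \<in> M" "v \<in> M" using s K'.vertices_subset by auto
      fix w
      have "oscillation_le K' (\<lambda>x. \<beta> x w) ((1 - 1 / real N) ^ m * 1)"
        using fine affine_coord[of w] oscillation_coord[of w] by metis
      then have "\<bar>\<beta> u w - \<beta> v w\<bar> \<le> (1 - 1 / real N) ^ m * 1"
        using s unfolding oscillation_le_def by simp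
      then show "\<bar>\<beta> u w - \<beta> v w\<bar> \<le> \<epsilon>" using m by simp
    qed
  qed
qed

end

section \<open>Labellings and odd maps\<close>

text \<open>At label 0 the definition falls into the negative branch on both sides, so the sign rule
  needs a nonzero label.\<close>

lemma labelled_point_uminus: "i \<noteq> 0 \<Longrightarrow> labelled_point p (- i) = - labelled_point p i"
  by (cases "i > 0") (simp_all add: labelled_point_def)

context triangulated
begin

lemma continuous_on_pl_extension: "continuous_on M (pl_extension K \<beta> L p)"
  unfolding pl_extension_def
  by (intro continuous_on_sum continuous_on_scaleR continuous_on_const continuous_on_coord)

text \<open>Reindexing the vertex sum along \<open>A\<close> moves the involution from the point to
  the labels, where it becomes a change of sign.\<close>

lemma pl_extension_odd:
  assumes A: "free_involution M A" and equiv: "equivariant M A K \<beta>"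
    and L: "equivariant_labelling n A K L" and x: "x \<in> M"
  shows "pl_extension K \<beta> L p (A x) = - pl_extension K \<beta> L p x"
proof -
  have "pl_extension K \<beta> L p (A x) = (\<Sum>v\<in>\<Union>K. \<beta> (A x) (A v) *\<^sub>R labelled_point p (L (A v)))"
    unfolding pl_extension_def
    by (rule sum.reindex_bij_betw[OF bij_betw_vertices[OF A equiv], symmetric])
  also have "\<dots> = (\<Sum>v\<in>\<Union>K. - (\<beta> x v *\<^sub>R labelled_point p (L v)))"
  proof (rule sum.cong)
    fix v assume v: "v \<in> \<Union>K"
    have "L v \<in> {1..int n} \<union> {- int n..-1} \<and> L (A v) = - L v"
      using L v unfolding equivariant_labelling_def by (rule bspec)
    then have nz: "L v \<noteq> 0" and "L (A v) = - L v" by auto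
    from this(2) show "\<beta> (A x) (A v) *\<^sub>R labelled_point p (L (A v)) = - (\<beta> x v *\<^sub>R labelled_point p (L v))"
      by (simp only: equivariant_coord[OF A equiv x v] labelled_point_uminus[OF nz] scaleR_minus_right)
  qed simp
  finally show ?thesis by (simp only: pl_extension_def sum_negf)
qed

lemma BUT_imp_hits_zero:
  assumes A: "free_involution M A" and equiv: "equivariant M A K \<beta>"
    and L: "equivariant_labelling n A K L"
    and BUT: "BUT TYPE('d::euclidean_space) M A"
  shows "\<exists>s\<in>K. (0::'d) \<in> pl_extension K \<beta> L p ` simplex_points M \<beta> s"
proof -
  let ?g = "pl_extension K \<beta> L p :: 'a \<Rightarrow> 'd"
  obtain x where x: "x \<in> M" "?g (A x) = ?g x"
    using BUT continuous_on_pl_extension unfolding BUT_def by metis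
  have "2 *\<^sub>R ?g x = 0"
    using x(2) unfolding pl_extension_odd[OF A equiv L x(1)] scaleR_2 by (metis add.right_inverse)
  then have "?g x = 0" by simp
  moreover have "x \<in> simplex_points M \<beta> {v. \<beta> x v \<noteq> 0}"
    using x(1) by (simp add: simplex_points_def)
  ultimately have "0 \<in> ?g ` simplex_points M \<beta> {v. \<beta> x v \<noteq> 0}"
    by (metis imageI)
  then show ?thesis using coord_support[OF x(1)] by (rule bexI)
qed

text \<open>A free involution carries no continuity by definition. It follows from equivariance: the
  coordinates of \<open>A x\<close> are those of \<open>x\<close>, permuted, and \<open>h\<close>
  leads back to \<open>M\<close>.\<close>

lemma equivariant_imp_continuous_on:
  assumes A: "free_involution M A" and equiv: "equivariant M A K \<beta>"
  shows "continuous_on M A"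
proof -
  have AM: "A x \<in> M" if "x \<in> M" for x using A that unfolding free_involution_def by auto
  obtain h where h: "homeomorphism M (realization K) \<beta> h"
    using coord_homeomorphism by (elim exE)
  have "continuous_on M (\<lambda>x. \<beta> (A x))"
  proof (rule continuous_on_coordinatewise_then_product)
    fix u
    show "continuous_on M (\<lambda>x. \<beta> (A x) u)"
    proof (cases "u \<in> \<Union>K")
      case True
      then obtain v where v: "v \<in> \<Union>K" "u = A v"
        using bij_betw_imp_surj_on[OF bij_betw_vertices[OF A equiv]] by (metis imageE)
      show ?thesis
        by (rule continuous_on_eq[OF continuous_on_coord[of v]])
          (simp only: v(2) equivariant_coord[OF A equiv _ v(1)])
    next
      case False
      show ?thesis
        by (rule continuous_on_eq[OF continuous_on_const[of _ 0]])
          (simp only: coord_outside[OF AM False])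
    qed
  qed
  moreover have "(\<lambda>x. \<beta> (A x)) ` M \<subseteq> realization K"
    by (intro image_subsetI coord_realization AM)
  ultimately have "continuous_on M (\<lambda>x. h (\<beta> (A x)))"
    by (rule continuous_on_compose2[OF homeomorphism_cont2[OF h]])
  then show ?thesis
    by (rule continuous_on_eq) (rule homeomorphism_apply1[OF h AM])
qed

text \<open>
  Over a basis \<open>B\<close> chosen from the points, each vertex is labelled by the dominant coordinate of the
  odd map together with its sign. A zero in the image of a simplex would need two vertices with
  opposite labels, hence a large change of one coordinate across the simplex.
\<close>

lemma exists_labelling_missing_zero:
  fixes p :: "nat \<Rightarrow> 'd::euclidean_space" and f :: "'a \<Rightarrow> 'd"
  assumes A: "free_involution M A" and equiv: "equivariant M A K \<beta>"
    and span: "span (point_set n p) = UNIV"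
    and f: "continuous_on M f" and odd: "\<And>x. x \<in> M \<Longrightarrow> f (A x) = - f x"
    and nz: "\<And>x. x \<in> M \<Longrightarrow> f x \<noteq> 0"
  obtains K' \<beta>' L where "pl_triangulation M K' \<beta>'" "equivariant M A K' \<beta>'"
    "equivariant_labelling n A K' L" "\<And>x. x \<in> M \<Longrightarrow> pl_extension K' \<beta>' L p x \<noteq> 0"
proof -
  \<comment> \<open>The points \<open>p i\<close> alone suffice for choosing a basis, since adding
    their negatives does not enlarge the span.\<close>
  obtain B where B: "B \<subseteq> p ` {1..n}" "independent B" "p ` {1..n} \<subseteq> span B"
    using maximal_independent_subset by metis
  have "point_set n p \<subseteq> span B"
    unfolding point_set_def using B(3) by (auto intro: span_neg)
  then have span_B: "span B = UNIV"
    using span_minimal[OF _ subspace_span] span by (metis top.extremum_unique)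
  have fin_B: "finite B" using B(1) by (rule finite_subset) simp
  have rep_linear: "linear (\<lambda>y. representation B y b)" for b
    by (rule linearI) (simp_all add: representation_add representation_scale B(2) span_B)
  define F where "F b x = representation B (f x) b" for b x
  have F_cont: "continuous_on M (F b)" for b
    unfolding F_def
    by (rule continuous_on_compose2[OF linear_continuous_on f])
      (use rep_linear in \<open>auto simp: linear_conv_bounded_linear\<close>)
  have F_odd: "F b (A x) = - F b x" if "x \<in> M" for b x
    unfolding F_def odd[OF that] using linear_neg[OF rep_linear] .
  \<comment> \<open>By compactness the sum of the absolute coordinates of \<open>f\<close> is
    bounded below by a positive number; for empty \<open>M\<close> any positive number will
    do.\<close>
  obtain m where m: "0 < m" "\<And>x. x \<in> M \<Longrightarrow> m \<le> (\<Sum>b\<in>B. \<bar>F b x\<bar>)"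
  proof (cases "M = {}")
    case True
    then show ?thesis using that[of 1] by simp
  next
    case False
    have "continuous_on M (\<lambda>x. \<Sum>b\<in>B. \<bar>F b x\<bar>)"
      by (rule continuous_on_sum, rule continuous_on_rabs, rule F_cont)
    from continuous_attains_inf[OF compact_carrier False this]
    obtain x where x: "x \<in> M" "\<forall>y\<in>M. (\<Sum>b\<in>B. \<bar>F b x\<bar>) \<le> (\<Sum>b\<in>B. \<bar>F b y\<bar>)" by (elim bexE)
    have "(\<Sum>b\<in>B. \<bar>F b x\<bar>) \<noteq> 0"
    proof
      assume "(\<Sum>b\<in>B. \<bar>F b x\<bar>) = 0"
      then have "\<forall>b\<in>B. F b x = 0"
        by (subst (asm) sum_nonneg_eq_0_iff[OF fin_B]) simp_all
      moreover have "(\<Sum>b\<in>B. F b x *\<^sub>R b) = f x"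
        unfolding F_def by (rule sum_representation_eq[OF B(2) _ fin_B]) (simp_all add: span_B)
      ultimately show False using nz[OF x(1)] by simp
    qed
    moreover have "0 \<le> (\<Sum>b\<in>B. \<bar>F b x\<bar>)" by (rule sum_nonneg) simp
    ultimately have "0 < (\<Sum>b\<in>B. \<bar>F b x\<bar>)" by linarith
    then show ?thesis by (rule that) (rule bspec[OF x(2)])
  qed
  \<comment> \<open>A lower bound for the largest absolute coordinate, and at the same time the
    fineness required of the triangulation. The added 1 makes it positive without a separate proof
    that \<open>B\<close> is nonempty.\<close>
  define \<delta> where "\<delta> = m / (real (card B) + 1)"
  have \<delta>: "0 < \<delta>" unfolding \<delta>_def using m(1) by (intro divide_pos_pos) simp_all
  obtain K' \<beta>' where K': "pl_triangulation M K' \<beta>'" "equivariant M A K' \<beta>'"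
    and fine: "\<forall>s\<in>K'. \<forall>u\<in>s. \<forall>v\<in>s. (\<Sum>b\<in>B. \<bar>F b u - F b v\<bar>) < \<delta>"
    by (rule fine_equivariant_triangulation[OF A equiv F_cont \<delta>])
  interpret K': triangulated M K' \<beta>' by standard (rule K'(1))
  \<comment> \<open>Only absolute values enter the choice. As these agree at \<open>x\<close> and
    \<open>A x\<close>, ties are resolved in the same way at both points.\<close>
  define lead where "lead x = (SOME b. b \<in> B \<and> (\<forall>c\<in>B. \<bar>F c x\<bar> \<le> \<bar>F b x\<bar>))" for x
  have lead: "lead x \<in> B" "\<delta> \<le> \<bar>F (lead x) x\<bar>" if x: "x \<in> M" for x
  proof -
    have "B \<noteq> {}" using m(2)[OF x] m(1) by auto
    then have "Max ((\<lambda>b. \<bar>F b x\<bar>) ` B) \<in> (\<lambda>b. \<bar>F b x\<bar>) ` B" using fin_B by (intro Max_in) simp_all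
    then obtain b where b: "b \<in> B" "\<bar>F b x\<bar> = Max ((\<lambda>b. \<bar>F b x\<bar>) ` B)" by (elim imageE) simp
    then have "b \<in> B \<and> (\<forall>c\<in>B. \<bar>F c x\<bar> \<le> \<bar>F b x\<bar>)" using fin_B by simp
    then have t: "lead x \<in> B \<and> (\<forall>c\<in>B. \<bar>F c x\<bar> \<le> \<bar>F (lead x) x\<bar>)" unfolding lead_def by (rule someI)
    then show "lead x \<in> B" by (rule conjunct1)
    have "m \<le> (\<Sum>b\<in>B. \<bar>F b x\<bar>)" by (rule m(2)[OF x])
    also have "\<dots> \<le> (\<Sum>b\<in>B. \<bar>F (lead x) x\<bar>)" by (rule sum_mono) (use t in simp)
    also have "\<dots> \<le> \<bar>F (lead x) x\<bar> * (real (card B) + 1)" by (simp add: algebra_simps)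
    finally show "\<delta> \<le> \<bar>F (lead x) x\<bar>" unfolding \<delta>_def by (simp add: pos_divide_le_eq)
  qed
  have lead_A: "lead (A x) = lead x" if "x \<in> M" for x
    unfolding lead_def by (simp only: F_odd[OF that] abs_minus_cancel)
  define idx where "idx b = (SOME i. i \<in> {1..n} \<and> p i = b)" for b
  have idx: "idx b \<in> {1..n}" "p (idx b) = b" if "b \<in> B" for b
  proof -
    have "b \<in> p ` {1..n}" using B(1) that by (rule subsetD)
    then have "\<exists>i. i \<in> {1..n} \<and> p i = b" by auto
    then obtain i where "i \<in> {1..n} \<and> p i = b" by (elim exE)
    then have "idx b \<in> {1..n} \<and> p (idx b) = b" unfolding idx_def by (rule someI)
    then show "idx b \<in> {1..n}" "p (idx b) = b" by simp_all
  qed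
  define L where "L v = (if 0 < F (lead v) v then int (idx (lead v)) else - int (idx (lead v)))" for v
  have L: "equivariant_labelling n A K' L"
    unfolding equivariant_labelling_def
  proof
    fix v assume "v \<in> \<Union>K'"
    then have v: "v \<in> M" using K'.vertices_subset by auto
    have "F (lead v) v \<noteq> 0" using lead(2)[OF v] \<delta> by auto
    then have "L (A v) = - L v" unfolding L_def lead_A[OF v] F_odd[OF v] by simp
    moreover have "L v \<in> {1..int n} \<union> {- int n..-1}" unfolding L_def using idx(1)[OF lead(1)[OF v]] by simp
    ultimately show "L v \<in> {1..int n} \<union> {- int n..-1} \<and> L (A v) = - L v" by simp
  qed
  have label: "labelled_point p (L v) = sgn (F (lead v) v) *\<^sub>R lead v" if v: "v \<in> M" for v
  proof -
    have "F (lead v) v \<noteq> 0" using lead(2)[OF v] \<delta> by auto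
    then show ?thesis
      using idx[OF lead(1)[OF v]] by (auto simp: labelled_point_def L_def sgn_if)
  qed
  show ?thesis
  proof (rule that[OF K' L])
    fix x assume x: "x \<in> M"
    let ?s = "{v. \<beta>' x v \<noteq> 0}"
    have s: "?s \<in> K'" by (rule K'.coord_support[OF x])
    obtain v0 where v0: "\<beta>' x v0 \<noteq> 0" using K'.simplex_nonempty[OF s] by auto
    \<comment> \<open>It suffices to find one nonzero coordinate of the extension at
      \<open>x\<close>. Any vertex \<open>v0\<close> in the support singles out such a coordinate: a
      vertex contributes to coordinate \<open>b\<close> only if it leads with \<open>b\<close>, and
      all contributing vertices have the sign of \<open>v0\<close>.\<close>
    define b where "b = lead v0"
    have v0M: "v0 \<in> M" "v0 \<in> \<Union>K'" using s v0 K'.vertices_subset by auto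
    define summand where "summand v = \<beta>' x v * (sgn (F (lead v) v) * (if lead v = b then 1 else 0))" for v
    have rep: "representation B (pl_extension K' \<beta>' L p x) b = (\<Sum>v\<in>\<Union>K'. summand v)"
      unfolding pl_extension_def linear_sum[OF rep_linear]
    proof (rule sum.cong)
      fix v assume "v \<in> \<Union>K'"
      then have v: "v \<in> M" using K'.vertices_subset by auto
      show "representation B (\<beta>' x v *\<^sub>R labelled_point p (L v)) b = summand v"
        unfolding label[OF v] summand_def linear_scale[OF rep_linear]
          representation_basis[OF B(2) lead(1)[OF v]]
        by simp
    qed simp
    have pos: "0 < sgn (F b v0) * summand v" if v: "\<beta>' x v \<noteq> 0" "lead v = b" for v
    proof -
      have vM: "v \<in> M" using s v(1) K'.vertices_subset by auto
      have bB: "b \<in> B" unfolding b_def by (rule lead(1)[OF v0M(1)])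
      have "\<bar>F b v - F b v0\<bar> \<le> (\<Sum>b\<in>B. \<bar>F b v - F b v0\<bar>)"
        by (rule member_le_sum[OF bB _ fin_B]) simp
      also have "\<dots> < \<delta>" by (rule bspec[OF bspec[OF bspec[OF fine s]]]) (simp_all add: v(1) v0)
      finally have "\<bar>F b v - F b v0\<bar> < \<delta>" .
      moreover have "\<delta> \<le> \<bar>F b v\<bar>" using lead(2)[OF vM] v(2) by simp
      moreover have "\<delta> \<le> \<bar>F b v0\<bar>" using lead(2)[OF v0M(1)] b_def by simp
      \<comment> \<open>Two numbers of absolute value at least \<delta> and of opposite sign would
        differ by at least 2\<delta>.\<close>
      ultimately have "sgn (F b v0) * sgn (F b v) = 1" using \<delta> by (auto simp: sgn_if abs_if split: if_splits)
      moreover have "0 < \<beta>' x v" using K'.coord_nonneg[OF x, of v] v(1) by simp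
      ultimately show ?thesis unfolding summand_def v(2) by (simp add: algebra_simps)
    qed
    \<comment> \<open>Multiplication by the sign at \<open>v0\<close> treats both signs at once:
      every term becomes nonnegative and the one at \<open>v0\<close> positive.\<close>
    have "0 < (\<Sum>v\<in>\<Union>K'. sgn (F b v0) * summand v)"
    proof (rule sum_pos2[OF K'.finite_vertices v0M(2)])
      show "0 < sgn (F b v0) * summand v0" by (rule pos[OF v0]) (simp add: b_def)
      fix v
      show "0 \<le> sgn (F b v0) * summand v"
        using pos[of v] by (cases "\<beta>' x v \<noteq> 0 \<and> lead v = b") (auto simp: summand_def)
    qed
    then have "(\<Sum>v\<in>\<Union>K'. summand v) \<noteq> 0" unfolding sum_distrib_left[symmetric] by auto
    moreover have "representation B 0 b = 0" by (rule linear_0[OF rep_linear])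
    ultimately show "pl_extension K' \<beta>' L p x \<noteq> 0" using rep by metis
  qed
qed

end

text \<open>Without the spanning condition the backward implication can fail. On a torus with the
  involution (z, w) -> (-z, w), projection to the circle of z is a nowhere zero odd map to the
  plane, so the torus is not BUT. For points on a line, however, every extension is a real-valued
  odd map on a connected space and has a zero.\<close>

theorem theorem4p2:
  fixes M :: "'a::euclidean_space set" and A :: "'a \<Rightarrow> 'a"
    and n :: nat and p :: "nat \<Rightarrow> 'd::euclidean_space"
  assumes "card (point_set n p) = 2 * n"
    and "closed_pl_manifold DIM('d) M"
    and "free_simplicial_involution M A"
  shows "(span (point_set n p) = UNIV \<longrightarrow>
            (BUT TYPE('d) M A \<longleftrightarrow> every_labelling_hits_zero M A n p)) \<and>
         (BUT TYPE('d) M A \<longrightarrow> every_labelling_hits_zero M A n p)"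
proof -
  obtain K \<beta> where A: "free_involution M A" and K: "pl_triangulation M K \<beta>" and equiv: "equivariant M A K \<beta>"
    using assms(3) unfolding free_simplicial_involution_def by (elim conjE exE)
  have AM: "A x \<in> M" and AA: "A (A x) = x" if "x \<in> M" for x
    using A that unfolding free_involution_def by auto
  have forward: "every_labelling_hits_zero M A n p" if BUT: "BUT TYPE('d) M A"
    unfolding every_labelling_hits_zero_def
  proof (intro allI impI, elim conjE)
    fix K' \<beta>' L
    assume K': "pl_triangulation M K' \<beta>'" "equivariant M A K' \<beta>'" "equivariant_labelling n A K' L"
    interpret triangulated M K' \<beta>' by standard (rule K'(1))
    show "\<exists>s\<in>K'. 0 \<in> pl_extension K' \<beta>' L p ` simplex_points M \<beta>' s"
      by (rule BUT_imp_hits_zero[OF A K'(2,3) BUT])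
  qed
  have backward: "BUT TYPE('d) M A"
    if span: "span (point_set n p) = UNIV" and hits: "every_labelling_hits_zero M A n p"
    unfolding BUT_def
  proof (intro allI impI, rule ccontr)
    interpret triangulated M K \<beta> by standard (rule K)
    fix g :: "'a \<Rightarrow> 'd"
    assume g: "continuous_on M g" and no: "\<not> (\<exists>x\<in>M. g (A x) = g x)"
    define f where "f x = g x - g (A x)" for x
    have "continuous_on M (\<lambda>x. g (A x))"
      by (rule continuous_on_compose2[OF g equivariant_imp_continuous_on[OF A equiv]])
        (intro image_subsetI AM)
    then have f: "continuous_on M f"
      unfolding f_def by (intro continuous_on_diff g)
    have odd: "f (A x) = - f x" if "x \<in> M" for x
      unfolding f_def AA[OF that] by simp
    have nz: "f x \<noteq> 0" if "x \<in> M" for x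
      unfolding f_def using no that by auto
    show False
    proof (rule exists_labelling_missing_zero[OF A equiv span f odd nz])
      fix K' \<beta>' L
      assume K': "pl_triangulation M K' \<beta>'" "equivariant M A K' \<beta>'" "equivariant_labelling n A K' L"
        and missing: "\<And>x. x \<in> M \<Longrightarrow> pl_extension K' \<beta>' L p x \<noteq> 0"
      have "\<exists>s\<in>K'. 0 \<in> pl_extension K' \<beta>' L p ` simplex_points M \<beta>' s"
        using hits K' unfolding every_labelling_hits_zero_def by metis
      then obtain s x where "x \<in> simplex_points M \<beta>' s" "0 = pl_extension K' \<beta>' L p x"
        by (elim bexE imageE)
      then show False using missing[of x] by (simp add: simplex_points_def)
    qed
  qed
  show ?thesis using forward backward by metis
qed

end
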